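(* Fix finite nonempty sets $A$ and $\Omega$, a prior $\mu_0$ on $\Omega$ with $\mu_0(\omega)>0$ for all $\omega$, and a finite message set $M$ with $|M|>\max\{|\Omega|,|A|\}$. There is a set of environments of Lebesgue measure one in $[0,1]^{2|A||\Omega|}$ such that, for every environment in this set, the following three statements are equivalent: (i) commitment is valuable; (ii) committed Sender values randomization; (iii) for every optimal persuasion profile $(\sigma,\rho)$ there exists $m\in M_\sigma$ such that $\left|\arg\max_{a\in A}\sum_\omega \mu_m(\omega)u_R(a,\omega)\right|\ge 2$, where $\mu_m(\omega)=\frac{\mu_0(\omega)\sigma(m|\omega)}{\sum_{\omega'}\mu_0(\omega')\sigma(m|\omega')}$.
   Context: An environment is a pair $(u_S,u_R)$ of functions $A\times\Omega\to[0,1]$, identified with a point of $[0,1]^{2|A||\Omega|}$. A messaging strategy is $\sigma:\Omega\to\Delta M$ and an action strategy is $\rho:M\to\Delta A$. For $i\in\{S,R\}$, $U_i(\sigma,\rho)=\sum_{\omega,m,a}\mu_0(\omega)\sigma(m|\omega)\rho(a|m)u_i(a,\omega)$. A profile $(\sigma,\rho)$ is S-BR if $\sigma\in\arg\max_{\sigma'}U_S(\sigma',\rho)$, and R-BR if $\rho\in\arg\max_{\rho'}U_R(\sigma,\rho')$. A persuasion profile is an R-BR profile; the persuasion payoff is the maximum of $U_S$ over persuasion profiles; a persuasion profile attaining it is optimal. A cheap-talk equilibrium is an S-BR and R-BR profile; the cheap-talk payoff is the maximum of $U_S$ over cheap-talk equilibria. Commitment is valuable if the persuasion payoff strictly exceeds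 the cheap-talk payoff. $\sigma$ is partitional if for every $\omega$ some $m$ has $\sigma(m|\omega)=1$. The partitional persuasion payoff is the maximum of $U_S$ over persuasion profiles with partitional $\sigma$. Committed Sender values randomization if the persuasion payoff strictly exceeds the partitional persuasion payoff. $M_\sigma=\{m\in M:\sigma(m|\omega)>0\text{ for some }\omega\}$. *)

theory Defs
  imports "HOL-Analysis.Analysis"
begin

text \<open>States: finite type 'w; actions: finite type 'a; messages: finite type 'm.
  Utilities are functions 'a => 'w => real. A messaging strategy is
  sig :: 'w => 'm => real (sig w m = probability of message m in state w);
  an action strategy is rho :: 'm => 'a => real.\<close>

definition is_prior :: "('w::finite \<Rightarrow> real) \<Rightarrow> bool" where
  "is_prior mu0 \<longleftrightarrow> (\<forall>w. mu0 w > 0) \<and> (\<Sum>w\<in>UNIV. mu0 w) = 1"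

definition msg_strategy :: "('w::finite \<Rightarrow> 'm::finite \<Rightarrow> real) \<Rightarrow> bool" where
  "msg_strategy sig \<longleftrightarrow> (\<forall>w m. sig w m \<ge> 0) \<and> (\<forall>w. (\<Sum>m\<in>UNIV. sig w m) = 1)"

definition act_strategy :: "('m::finite \<Rightarrow> 'a::finite \<Rightarrow> real) \<Rightarrow> bool" where
  "act_strategy rho \<longleftrightarrow> (\<forall>m a. rho m a \<ge> 0) \<and> (\<forall>m. (\<Sum>a\<in>UNIV. rho m a) = 1)"

definition payoff ::
  "('w::finite \<Rightarrow> real) \<Rightarrow> ('a::finite \<Rightarrow> 'w \<Rightarrow> real) \<Rightarrow>
   ('w \<Rightarrow> 'm::finite \<Rightarrow> real) \<Rightarrow> ('m \<Rightarrow> 'a \<Rightarrow> real) \<Rightarrow> real" where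
  "payoff mu0 u sig rho =
     (\<Sum>w\<in>UNIV. \<Sum>m\<in>UNIV. \<Sum>a\<in>UNIV. mu0 w * sig w m * rho m a * u a w)"

definition S_BR where
  "S_BR mu0 uS sig rho \<longleftrightarrow> msg_strategy sig \<and>
     (\<forall>sig'. msg_strategy sig' \<longrightarrow> payoff mu0 uS sig' rho \<le> payoff mu0 uS sig rho)"

definition R_BR where
  "R_BR mu0 uR sig rho \<longleftrightarrow> act_strategy rho \<and>
     (\<forall>rho'. act_strategy rho' \<longrightarrow> payoff mu0 uR sig rho' \<le> payoff mu0 uR sig rho)"

definition persuasion_profile where
  "persuasion_profile mu0 uR sig rho \<longleftrightarrow> msg_strategy sig \<and> act_strategy rho \<and> R_BR mu0 uR sig rho"

definition cheap_talk_eq where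
  "cheap_talk_eq mu0 uS uR sig rho \<longleftrightarrow> msg_strategy sig \<and> act_strategy rho \<and>
     S_BR mu0 uS sig rho \<and> R_BR mu0 uR sig rho"

definition partitional :: "('w \<Rightarrow> 'm \<Rightarrow> real) \<Rightarrow> bool" where
  "partitional sig \<longleftrightarrow> (\<forall>w. \<exists>m. sig w m = 1)"

text \<open>The maxima below exist; we write them as suprema.\<close>
definition persuasion_payoff ::
  "('w::finite \<Rightarrow> real) \<Rightarrow> ('a::finite \<Rightarrow> 'w \<Rightarrow> real) \<Rightarrow> ('a \<Rightarrow> 'w \<Rightarrow> real) \<Rightarrow>
   'm::finite itself \<Rightarrow> real" where
  "persuasion_payoff mu0 uS uR (_::'m itself) =
     Sup {payoff mu0 uS sig rho | (sig :: 'w \<Rightarrow> 'm \<Rightarrow> real) rho. persuasion_profile mu0 uR sig rho}"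

definition partitional_persuasion_payoff ::
  "('w::finite \<Rightarrow> real) \<Rightarrow> ('a::finite \<Rightarrow> 'w \<Rightarrow> real) \<Rightarrow> ('a \<Rightarrow> 'w \<Rightarrow> real) \<Rightarrow>
   'm::finite itself \<Rightarrow> real" where
  "partitional_persuasion_payoff mu0 uS uR (_::'m itself) =
     Sup {payoff mu0 uS sig rho | (sig :: 'w \<Rightarrow> 'm \<Rightarrow> real) rho.
            persuasion_profile mu0 uR sig rho \<and> partitional sig}"

definition cheap_talk_payoff ::
  "('w::finite \<Rightarrow> real) \<Rightarrow> ('a::finite \<Rightarrow> 'w \<Rightarrow> real) \<Rightarrow> ('a \<Rightarrow> 'w \<Rightarrow> real) \<Rightarrow>
   'm::finite itself \<Rightarrow> real" where
  "cheap_talk_payoff mu0 uS uR (_::'m itself) =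
     Sup {payoff mu0 uS sig rho | (sig :: 'w \<Rightarrow> 'm \<Rightarrow> real) rho. cheap_talk_eq mu0 uS uR sig rho}"

definition optimal_persuasion_profile ::
  "('w::finite \<Rightarrow> real) \<Rightarrow> ('a::finite \<Rightarrow> 'w \<Rightarrow> real) \<Rightarrow> ('a \<Rightarrow> 'w \<Rightarrow> real) \<Rightarrow>
   ('w \<Rightarrow> 'm::finite \<Rightarrow> real) \<Rightarrow> ('m \<Rightarrow> 'a \<Rightarrow> real) \<Rightarrow> bool" where
  "optimal_persuasion_profile mu0 uS uR sig rho \<longleftrightarrow>
     persuasion_profile mu0 uR sig rho \<and>
     payoff mu0 uS sig rho = persuasion_payoff mu0 uS uR TYPE('m)"

definition commitment_valuable where
  "commitment_valuable mu0 uS uR (t::'m::finite itself) \<longleftrightarrow>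
     persuasion_payoff mu0 uS uR t > cheap_talk_payoff mu0 uS uR t"

definition values_randomization where
  "values_randomization mu0 uS uR (t::'m::finite itself) \<longleftrightarrow>
     persuasion_payoff mu0 uS uR t > partitional_persuasion_payoff mu0 uS uR t"

definition used_messages :: "('w::finite \<Rightarrow> 'm \<Rightarrow> real) \<Rightarrow> 'm set" where
  "used_messages sig = {m. \<exists>w. sig w m > 0}"

definition posterior :: "('w::finite \<Rightarrow> real) \<Rightarrow> ('w \<Rightarrow> 'm \<Rightarrow> real) \<Rightarrow> 'm \<Rightarrow> 'w \<Rightarrow> real" where
  "posterior mu0 sig m w = mu0 w * sig w m / (\<Sum>w'\<in>UNIV. mu0 w' * sig w' m)"

definition argmax_set :: "('a \<Rightarrow> real) \<Rightarrow> 'a set" where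
  "argmax_set f = {a. \<forall>a'. f a' \<le> f a}"

text \<open>An environment is a point of R^(2|A||Omega|), indexed by bool x 'a x 'w:
  index (True,a,w) is u_S(a,w) and index (False,a,w) is u_R(a,w).\<close>
definition envS :: "(bool \<times> 'a \<times> 'w \<Rightarrow> real) \<Rightarrow> 'a \<Rightarrow> 'w \<Rightarrow> real" where
  "envS e a w = e (True, a, w)"
definition envR :: "(bool \<times> 'a \<times> 'w \<Rightarrow> real) \<Rightarrow> 'a \<Rightarrow> 'w \<Rightarrow> real" where
  "envR e a w = e (False, a, w)"

definition env_cube :: "(bool \<times> 'a \<times> 'w \<Rightarrow> real) set" where
  "env_cube = {e. \<forall>i. 0 \<le> e i \<and> e i \<le> 1}"

abbreviation env_lebesgue :: "(bool \<times> 'a::finite \<times> 'w::finite \<Rightarrow> real) measure" where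
  "env_lebesgue \<equiv> PiM UNIV (\<lambda>_. lborel)"

end

theory Submission
  imports Defs
begin

text \<open>
  For almost every environment three things hold. (a) All optimal persuasion profiles induce the
  same joint distribution of actions and states: in each coordinate u_S(a, w) the persuasion payoff
  is convex with the probability of (a, w) as slope, so disagreement only occurs at kinks, and
  Fubini applies. (b) Sender is never indifferent between two actions in a known state. (c) Receiver
  is never indifferent between two actions when told only that the state lies in a given nonempty
  set.

  By (c), an optimal partitional profile has unique best responses after every used message. If an
  optimal profile has unique, hence strict, best responses, then a state preferring the action of
  another used message could shift a little mass to it without affecting Receiver, so optimality
  makes the profile a cheap-talk equilibrium. Finally, in a cheap-talk equilibrium attaining the
  persuasion payoff, Receiver does not mix after a used message: any action in the support could be
  played for sure without loss, giving optimal profiles with different outcomes, against (a). By (b)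
  each state then induces a single action, and pooling the messages with the same action yields a
  partitional profile with the same payoff.
\<close>

section \<open>Topological and measure-theoretic preliminaries\<close>

text \<open>Sequential compactness of S lets the witnesses of a convergent sequence be thinned to a
  convergent subsequence, and closedness of T passes to the limit pair. With S the set of strategy
  profiles, it turns "some profile satisfies a closed condition" into a closed condition on the
  environment.\<close>

lemma closed_projection_compact:
  fixes S :: "'a::first_countable_topology set"
    and T :: "('a \<times> 'b::first_countable_topology) set"
  assumes "compact S" "closed T"
  shows "closed {y. \<exists>x\<in>S. (x, y) \<in> T}"
  unfolding closed_sequential_limits
proof (intro allI impI, elim conjE)
  fix y l
  assume "\<forall>n. y n \<in> {y. \<exists>x\<in>S. (x, y) \<in> T}" and lim: "y \<longlonglongrightarrow> l"
  then obtain x where x: "\<And>n. x n \<in> S" "\<And>n. (x n, y n) \<in> T"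
    by (simp add: Bex_def) metis
  obtain p r where p: "p \<in> S" "strict_mono (r :: nat \<Rightarrow> nat)" "(x \<circ> r) \<longlonglongrightarrow> p"
    using seq_compactE[OF compact_imp_seq_compact[OF assms(1)]] x(1) by metis
  have "(\<lambda>n. ((x \<circ> r) n, (y \<circ> r) n)) \<longlonglongrightarrow> (p, l)"
    by (intro tendsto_Pair p(3) LIMSEQ_subseq_LIMSEQ[OF lim p(2)])
  then have "(p, l) \<in> T"
    using assms(2) x(2) unfolding closed_sequential_limits by fastforce
  then show "l \<in> {y. \<exists>x\<in>S. (x, y) \<in> T}"
    using p(1) by blast
qed

text \<open>Tychonoff's theorem, transferred from the abstract product topology to the function
  space.\<close>

lemma compact_Pi_UNIV:
  fixes K :: "'i \<Rightarrow> 'b::topological_space set"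
  assumes "\<And>i. compact (K i)"
  shows "compact {f. \<forall>i. f i \<in> K i}"
proof -
  have "compactin (product_topology (\<lambda>i. euclidean) UNIV) (Pi\<^sub>E UNIV K)"
    unfolding compactin_PiE using assms by auto
  moreover have "Pi\<^sub>E UNIV K = {f. \<forall>i. f i \<in> K i}"
    by auto
  ultimately show ?thesis
    by (simp add: euclidean_product_topology)
qed

text \<open>Tonelli in coordinate i: every line parallel to that axis meets N in at most one point,
  so the inner integral vanishes everywhere. Each genericity condition below is reduced to this
  criterion by a suitable choice of coordinate.\<close>

lemma PiM_lborel_null_set_by_slices:
  fixes N :: "('i::finite \<Rightarrow> real) set" and i :: 'i
  assumes N: "N \<in> sets (PiM UNIV (\<lambda>_. lborel))"
    and slice: "\<And>x s t. \<lbrakk>x(i := s) \<in> N; x(i := t) \<in> N\<rbrakk> \<Longrightarrow> s = t"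
  shows "N \<in> null_sets (PiM UNIV (\<lambda>_. lborel))"
proof -
  interpret product_sigma_finite "\<lambda>_::'i. lborel :: real measure"
    by unfold_locales
  have ins: "insert i (UNIV - {i}) = UNIV"
    by auto
  have "emeasure (PiM UNIV (\<lambda>_. lborel)) N
      = (\<integral>\<^sup>+ x. indicator N x \<partial>PiM (insert i (UNIV - {i})) (\<lambda>_. lborel))"
    using N by (simp add: ins)
  also have "\<dots> = (\<integral>\<^sup>+ x. (\<integral>\<^sup>+ t. indicator N (x(i := t)) \<partial>lborel)
                   \<partial>PiM (UNIV - {i}) (\<lambda>_. lborel))"
    by (rule product_nn_integral_insert) (use N in \<open>simp_all add: ins\<close>)
  also have "\<dots> = (\<integral>\<^sup>+ x. 0 \<partial>PiM (UNIV - {i}) (\<lambda>_. lborel :: real measure))"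
  proof (rule nn_integral_cong)
    fix x :: "'i \<Rightarrow> real"
    have "countable {t. x(i := t) \<in> N}"
    proof (cases "\<exists>t. x(i := t) \<in> N")
      case True
      then obtain t where "x(i := t) \<in> N" ..
      then have "{t. x(i := t) \<in> N} \<subseteq> {t}"
        using slice by auto
      then show ?thesis
        using countable_subset by blast
    qed simp
    then have null: "{t. x(i := t) \<in> N} \<in> null_sets lborel"
      by (rule countable_imp_null_set_lborel)
    have "(\<integral>\<^sup>+ t. indicator N (x(i := t)) \<partial>lborel)
        = (\<integral>\<^sup>+ t. indicator {t. x(i := t) \<in> N} t \<partial>lborel)"
      by (intro nn_integral_cong) (simp add: indicator_def)
    also have "\<dots> = 0"
      using null by (auto simp: null_sets_def)
    finally show "(\<integral>\<^sup>+ t. indicator N (x(i := t)) \<partial>lborel) = 0" .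
  qed
  finally show ?thesis
    using N by (simp add: null_sets_def)
qed

lemma sum_weights_const_on_support:
  fixes p v :: "'j::finite \<Rightarrow> real"
  assumes "\<And>j. 0 \<le> p j" "(\<Sum>j\<in>UNIV. p j) = 1"
    and "\<And>j. p j > 0 \<Longrightarrow> v j = c"
  shows "(\<Sum>j\<in>UNIV. p j * v j) = c"
proof -
  have "(\<Sum>j\<in>UNIV. p j * v j) = (\<Sum>j\<in>UNIV. p j * c)"
    by (intro sum.cong refl) (metis assms(1,3) mult_eq_0_iff order_le_less)
  then show ?thesis
    using assms(2) by (simp flip: sum_distrib_right)
qed

text \<open>A linear objective on a product of simplices is maximised row by row, by putting mass
  only on best columns. Both best-response conditions are instances: rows are messages for Receiver
  and states for Sender.\<close>

lemma stochastic_maximizer_iff: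
  fixes p v :: "'i::finite \<Rightarrow> 'j::finite \<Rightarrow> real"
  assumes p0: "\<forall>i j. 0 \<le> p i j" and p1: "\<forall>i. (\<Sum>j\<in>UNIV. p i j) = 1"
  shows "(\<forall>q. (\<forall>i j. 0 \<le> q i j) \<and> (\<forall>i. (\<Sum>j\<in>UNIV. q i j) = 1) \<longrightarrow>
            (\<Sum>i\<in>UNIV. \<Sum>j\<in>UNIV. q i j * v i j) \<le> (\<Sum>i\<in>UNIV. \<Sum>j\<in>UNIV. p i j * v i j))
     \<longleftrightarrow> (\<forall>i j k. p i j > 0 \<longrightarrow> v i k \<le> v i j)"
    (is "?max \<longleftrightarrow> ?supp")
proof
  assume max: ?max
  show ?supp
  proof (intro allI impI)
    fix i j k
    assume pos: "p i j > 0"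
    show "v i k \<le> v i j"
    proof (rule ccontr)
      assume gt: "\<not> v i k \<le> v i j"
      \<comment> \<open>In row i the entire mass at j moves to the better column k. This keeps
        entries nonnegative and row sums unchanged, and raises the objective by
        \<open>p i j * (v i k - v i j)\<close>.\<close>
      define d where "d l = p i j * (of_bool (l = k) - of_bool (l = j))" for l
      define q where "q i' l = p i' l + of_bool (i' = i) * d l" for i' l
      have "0 \<le> q i' l" for i' l
        using p0 pos by (auto simp: q_def d_def of_bool_def)
      moreover have "(\<Sum>l\<in>UNIV. d l) = 0"
        by (simp add: d_def sum_subtractf flip: sum_distrib_left)
      then have "(\<Sum>l\<in>UNIV. q i' l) = 1" for i'
        using p1 by (simp add: q_def sum.distrib flip: sum_distrib_left)
      moreover have "(\<Sum>i\<in>UNIV. \<Sum>j\<in>UNIV. q i j * v i j)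
          = (\<Sum>i\<in>UNIV. \<Sum>j\<in>UNIV. p i j * v i j) + (\<Sum>l\<in>UNIV. d l * v i l)"
      proof -
        have "(\<Sum>i'\<in>UNIV. \<Sum>l\<in>UNIV. of_bool (i' = i) * d l * v i' l) =
              (\<Sum>i'\<in>UNIV. of_bool (i' = i) * (\<Sum>l\<in>UNIV. d l * v i' l))"
          by (simp add: sum_distrib_left mult.assoc)
        then show ?thesis
          by (simp add: q_def distrib_right sum.distrib)
      qed
      moreover have "(\<Sum>l\<in>UNIV. d l * v i l) = p i j * (v i k - v i j)"
      proof -
        have "d l * v i l = p i j * (of_bool (l = k) * v i l) - p i j * (of_bool (l = j) * v i l)" for l
          by (simp add: d_def algebra_simps)
        then show ?thesis
          by (simp only: sum_subtractf flip: sum_distrib_left) (simp add: right_diff_distrib)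
      qed
      moreover have "p i j * (v i k - v i j) > 0"
        using pos gt by simp
      ultimately show False
        using max[rule_format, of q] by simp
    qed
  qed
next
  assume supp: ?supp
  show ?max
  proof (intro allI impI, elim conjE, rule sum_mono)
    fix q :: "'i \<Rightarrow> 'j \<Rightarrow> real" and i
    assume q0: "\<forall>i j. 0 \<le> q i j" and q1: "\<forall>i. (\<Sum>j\<in>UNIV. q i j) = 1"
    have "\<exists>j. p i j > 0"
      using p0 p1 by (metis order_le_less sum.neutral zero_neq_one)
    then obtain j0 where j0: "p i j0 > 0" ..
    have "(\<Sum>j\<in>UNIV. q i j * v i j) \<le> (\<Sum>j\<in>UNIV. q i j * v i j0)"
      by (intro sum_mono mult_left_mono) (use supp j0 q0 in auto)
    also have "\<dots> = v i j0"
      using q1 by (simp flip: sum_distrib_right)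
    also have "\<dots> = (\<Sum>j\<in>UNIV. p i j * v i j)"
      using p0 p1 supp j0
      by (intro sum_weights_const_on_support[symmetric]) (auto intro: antisym)
    finally show "(\<Sum>j\<in>UNIV. q i j * v i j) \<le> (\<Sum>j\<in>UNIV. p i j * v i j)" .
  qed
qed

section \<open>Payoffs and best responses\<close>

text \<open>Not normalised by the probability of the message, so it vanishes at unused messages.\<close>

definition interim ::
  "('w::finite \<Rightarrow> real) \<Rightarrow> ('a \<Rightarrow> 'w \<Rightarrow> real) \<Rightarrow> ('w \<Rightarrow> 'm \<Rightarrow> real) \<Rightarrow> 'm \<Rightarrow> 'a \<Rightarrow> real" where
  "interim mu0 u sig m a = (\<Sum>w\<in>UNIV. mu0 w * sig w m * u a w)"

text \<open>For a prior and strategies this is the joint distribution of action and state. It is the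
  coefficient of \<open>u a w\<close> in the payoff, hence the slope of the payoff in that utility
  coordinate.\<close>

definition outcome ::
  "('w \<Rightarrow> real) \<Rightarrow> ('w \<Rightarrow> 'm::finite \<Rightarrow> real) \<Rightarrow> ('m \<Rightarrow> 'a \<Rightarrow> real) \<Rightarrow> 'a \<Rightarrow> 'w \<Rightarrow> real" where
  "outcome mu0 sig rho a w = (\<Sum>m\<in>UNIV. mu0 w * sig w m * rho m a)"

text \<open>This and the next two lemmas regroup one triple sum: by message and action for
  Receiver's problem, by action and state for the dependence on utilities, by state and message for
  Sender's problem.\<close>

lemma payoff_interim:
  "payoff mu0 u sig rho = (\<Sum>m\<in>UNIV. \<Sum>a\<in>UNIV. rho m a * interim mu0 u sig m a)"
proof -
  have "payoff mu0 u sig rho = (\<Sum>m\<in>UNIV. \<Sum>w\<in>UNIV. \<Sum>a\<in>UNIV. mu0 w * sig w m * rho m a * u a w)"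
    unfolding payoff_def by (rule sum.swap)
  also have "\<dots> = (\<Sum>m\<in>UNIV. \<Sum>a\<in>UNIV. \<Sum>w\<in>UNIV. mu0 w * sig w m * rho m a * u a w)"
    by (intro sum.cong refl, rule sum.swap)
  finally show ?thesis
    by (simp add: interim_def sum_distrib_left mult_ac)
qed

lemma payoff_outcome:
  "payoff mu0 u sig rho = (\<Sum>a\<in>UNIV. \<Sum>w\<in>UNIV. outcome mu0 sig rho a w * u a w)"
proof -
  have "payoff mu0 u sig rho = (\<Sum>w\<in>UNIV. \<Sum>a\<in>UNIV. \<Sum>m\<in>UNIV. mu0 w * sig w m * rho m a * u a w)"
    unfolding payoff_def by (intro sum.cong refl, rule sum.swap)
  also have "\<dots> = (\<Sum>a\<in>UNIV. \<Sum>w\<in>UNIV. \<Sum>m\<in>UNIV. mu0 w * sig w m * rho m a * u a w)"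
    by (rule sum.swap)
  finally show ?thesis
    by (simp add: outcome_def sum_distrib_right)
qed

lemma payoff_by_state:
  "payoff mu0 u sig rho =
     (\<Sum>w\<in>UNIV. \<Sum>m\<in>UNIV. sig w m * (mu0 w * (\<Sum>a\<in>UNIV. rho m a * u a w)))"
  by (simp add: payoff_def sum_distrib_left mult_ac)

lemma R_BR_iff:
  assumes "act_strategy rho"
  shows "R_BR mu0 uR sig rho \<longleftrightarrow>
    (\<forall>m a b. rho m a > 0 \<longrightarrow> interim mu0 uR sig m b \<le> interim mu0 uR sig m a)"
proof -
  have "(\<forall>rho'. act_strategy rho' \<longrightarrow> payoff mu0 uR sig rho' \<le> payoff mu0 uR sig rho) \<longleftrightarrow>
    (\<forall>m a b. rho m a > 0 \<longrightarrow> interim mu0 uR sig m b \<le> interim mu0 uR sig m a)"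
    unfolding act_strategy_def payoff_interim
    by (rule stochastic_maximizer_iff) (use assms in \<open>simp_all add: act_strategy_def\<close>)
  with assms show ?thesis
    unfolding R_BR_def by blast
qed

text \<open>\<open>stochastic_maximizer_iff\<close> applied with states as rows. The weight
  \<open>mu0 w\<close> cancels because the prior is positive, leaving a comparison of utilities
  state by state.\<close>

lemma S_BR_iff:
  assumes "is_prior mu0" "msg_strategy sig"
  shows "S_BR mu0 uS sig rho \<longleftrightarrow>
    (\<forall>w m m'. sig w m > 0 \<longrightarrow>
       (\<Sum>a\<in>UNIV. rho m' a * uS a w) \<le> (\<Sum>a\<in>UNIV. rho m a * uS a w))"
proof -
  have "(\<forall>sig'. msg_strategy sig' \<longrightarrow> payoff mu0 uS sig' rho \<le> payoff mu0 uS sig rho) \<longleftrightarrow>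
    (\<forall>w m m'. sig w m > 0 \<longrightarrow>
       mu0 w * (\<Sum>a\<in>UNIV. rho m' a * uS a w) \<le> mu0 w * (\<Sum>a\<in>UNIV. rho m a * uS a w))"
    unfolding msg_strategy_def payoff_by_state
    by (rule stochastic_maximizer_iff) (use assms in \<open>simp_all add: msg_strategy_def\<close>)
  moreover have "mu0 w * x \<le> mu0 w * y \<longleftrightarrow> x \<le> y" for w x y
    using assms(1) by (simp add: is_prior_def)
  ultimately show ?thesis
    using assms(2) unfolding S_BR_def by simp
qed

lemma persuasion_profile_iff:
  "persuasion_profile mu0 uR sig rho \<longleftrightarrow> msg_strategy sig \<and> act_strategy rho \<and>
     (\<forall>m a b. rho m a > 0 \<longrightarrow> interim mu0 uR sig m b \<le> interim mu0 uR sig m a)"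
  unfolding persuasion_profile_def using R_BR_iff by blast

section \<open>Continuity of payoffs, closedness and compactness of sets of profiles\<close>

lemma continuous_on_apply2:
  "continuous_on S f \<Longrightarrow> continuous_on S (\<lambda>x. f x i j)"
  by (rule continuous_on_product_then_coordinatewise[OF continuous_on_product_then_coordinatewise])

lemma continuous_on_payoff [continuous_intros]:
  assumes "continuous_on S u" "continuous_on S sig" "continuous_on S rho"
  shows "continuous_on S (\<lambda>x. payoff mu0 (u x) (sig x) (rho x))"
  unfolding payoff_def
  by (intro continuous_intros assms[THEN continuous_on_apply2])

lemma continuous_on_envs [continuous_intros]:
  assumes "continuous_on S e"
  shows "continuous_on S (\<lambda>x. envS (e x))" "continuous_on S (\<lambda>x. envR (e x))"
  unfolding envS_def envR_def
  by (intro continuous_on_coordinatewise_then_product continuous_on_product_then_coordinatewise[OF assms])+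

lemma continuous_on_outcome [continuous_intros]:
  assumes "continuous_on S sig" "continuous_on S rho"
  shows "continuous_on S (\<lambda>x. outcome mu0 (sig x) (rho x) a w)"
  unfolding outcome_def
  by (intro continuous_intros assms[THEN continuous_on_apply2])

lemma closed_Collect_msg_strategy:
  fixes sig :: "'b::topological_space \<Rightarrow> 'w::finite \<Rightarrow> 'm::finite \<Rightarrow> real"
  assumes "continuous_on UNIV sig"
  shows "closed {x. msg_strategy (sig x)}"
  unfolding msg_strategy_def
  by (intro closed_Collect_conj closed_Collect_all closed_Collect_le closed_Collect_eq
      continuous_intros continuous_on_apply2[OF assms])

lemma closed_Collect_act_strategy:
  fixes rho :: "'b::topological_space \<Rightarrow> 'm::finite \<Rightarrow> 'a::finite \<Rightarrow> real"
  assumes "continuous_on UNIV rho"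
  shows "closed {x. act_strategy (rho x)}"
  unfolding act_strategy_def
  by (intro closed_Collect_conj closed_Collect_all closed_Collect_le closed_Collect_eq
      continuous_intros continuous_on_apply2[OF assms])

text \<open>Each fixed deviation contributes a weak inequality between continuous functions, and
  arbitrary intersections of closed sets are closed. Utilities may vary with x too, so the condition
  is closed jointly in profile and environment.\<close>

lemma closed_Collect_R_BR:
  fixes sig :: "'b::topological_space \<Rightarrow> 'w::finite \<Rightarrow> 'm::finite \<Rightarrow> real"
    and rho :: "'b \<Rightarrow> 'm \<Rightarrow> 'a::finite \<Rightarrow> real"
  assumes "continuous_on UNIV uR" "continuous_on UNIV sig" "continuous_on UNIV rho"
  shows "closed {x. R_BR mu0 (uR x) (sig x) (rho x)}"
  unfolding R_BR_def
  by (intro closed_Collect_conj closed_Collect_all closed_Collect_imp closed_Collect_le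
      closed_Collect_act_strategy open_Collect_const continuous_intros assms)

lemma closed_Collect_S_BR:
  fixes sig :: "'b::topological_space \<Rightarrow> 'w::finite \<Rightarrow> 'm::finite \<Rightarrow> real"
    and rho :: "'b \<Rightarrow> 'm \<Rightarrow> 'a::finite \<Rightarrow> real"
  assumes "continuous_on UNIV uS" "continuous_on UNIV sig" "continuous_on UNIV rho"
  shows "closed {x. S_BR mu0 (uS x) (sig x) (rho x)}"
  unfolding S_BR_def
  by (intro closed_Collect_conj closed_Collect_all closed_Collect_imp closed_Collect_le
      closed_Collect_msg_strategy open_Collect_const continuous_intros assms)

lemma closed_Collect_persuasion_profile:
  fixes sig :: "'b::topological_space \<Rightarrow> 'w::finite \<Rightarrow> 'm::finite \<Rightarrow> real"
    and rho :: "'b \<Rightarrow> 'm \<Rightarrow> 'a::finite \<Rightarrow> real"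
  assumes "continuous_on UNIV uR" "continuous_on UNIV sig" "continuous_on UNIV rho"
  shows "closed {x. persuasion_profile mu0 (uR x) (sig x) (rho x)}"
  unfolding persuasion_profile_def
  by (intro closed_Collect_conj closed_Collect_msg_strategy closed_Collect_act_strategy
      closed_Collect_R_BR assms)

text \<open>For each state the condition is a union over messages of closed sets, which stays closed
  because there are finitely many messages.\<close>

lemma closed_Collect_partitional:
  fixes sig :: "'b::topological_space \<Rightarrow> 'w::finite \<Rightarrow> 'm::finite \<Rightarrow> real"
  assumes "continuous_on UNIV sig"
  shows "closed {x. partitional (sig x)}"
proof -
  have "{x. partitional (sig x)} = (\<Inter>w. \<Union>m. {x. sig x w m = 1})"
    by (auto simp: partitional_def)
  moreover have "closed {x. sig x w m = 1}" for w m
    by (intro closed_Collect_eq continuous_intros continuous_on_apply2[OF assms])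
  ultimately show ?thesis
    by (auto intro!: closed_INT closed_UN)
qed

definition strategy_profiles ::
  "(('w::finite \<Rightarrow> 'm::finite \<Rightarrow> real) \<times> ('m \<Rightarrow> 'a::finite \<Rightarrow> real)) set" where
  "strategy_profiles = {z. msg_strategy (fst z) \<and> act_strategy (snd z)}"

lemma stochastic_le_1:
  fixes p :: "'i \<Rightarrow> 'j::finite \<Rightarrow> real"
  assumes "\<forall>i j. 0 \<le> p i j" "\<forall>i. (\<Sum>j\<in>UNIV. p i j) = 1"
  shows "p i j \<le> 1"
  using member_le_sum[of j UNIV "p i"] assms by auto

text \<open>Nonnegative rows summing to one have entries at most 1, so the profiles form a closed
  subset of a product of unit intervals.\<close>

lemma compact_strategy_profiles: "compact (strategy_profiles ::
  (('w::finite \<Rightarrow> 'm::finite \<Rightarrow> real) \<times> ('m \<Rightarrow> 'a::finite \<Rightarrow> real)) set)"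
proof -
  have box: "compact {f :: 'i \<Rightarrow> 'j \<Rightarrow> real. \<forall>i. f i \<in> {g. \<forall>j. g j \<in> {0..1}}}"
    by (intro compact_Pi_UNIV compact_Icc)
  have "closed (strategy_profiles ::
      (('w::finite \<Rightarrow> 'm::finite \<Rightarrow> real) \<times> ('m \<Rightarrow> 'a::finite \<Rightarrow> real)) set)"
    unfolding strategy_profiles_def
    by (intro closed_Collect_conj closed_Collect_msg_strategy closed_Collect_act_strategy
        continuous_intros)
  from compact_Int_closed[OF compact_Times[OF box box] this]
  show ?thesis
    by (rule back_subst[where P = compact])
      (auto simp: strategy_profiles_def msg_strategy_def act_strategy_def stochastic_le_1)
qed

text \<open>The extreme value theorem on the compact set of profiles satisfying P. The predicate is
  kept abstract because the persuasion, partitional and cheap-talk payoffs all need their supremum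
  to be a maximum.\<close>

lemma payoff_attains_Sup:
  fixes mu :: "'w::finite \<Rightarrow> real" and u :: "'a::finite \<Rightarrow> 'w \<Rightarrow> real"
    and P :: "('w \<Rightarrow> 'm::finite \<Rightarrow> real) \<Rightarrow> ('m \<Rightarrow> 'a \<Rightarrow> real) \<Rightarrow> bool"
  assumes closed: "closed {z. P (fst z) (snd z)}"
    and strat: "\<And>sig rho. P sig rho \<Longrightarrow> msg_strategy sig \<and> act_strategy rho"
    and ex: "P sig0 rho0"
  obtains sig rho where "P sig rho"
    "payoff mu u sig rho = Sup {payoff mu u sig rho | sig rho. P sig rho}"
    "\<And>sig' rho'. P sig' rho' \<Longrightarrow> payoff mu u sig' rho' \<le> payoff mu u sig rho"
proof -
  let ?C = "{z. P (fst z) (snd z)}"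
  have "compact (strategy_profiles \<inter> ?C)"
    by (intro compact_Int_closed compact_strategy_profiles closed)
  moreover have "strategy_profiles \<inter> ?C = ?C"
    using strat by (auto simp: strategy_profiles_def)
  ultimately have "compact ?C"
    by simp
  moreover have "?C \<noteq> {}"
    using ex by auto
  moreover have "continuous_on ?C (\<lambda>z. payoff mu u (fst z) (snd z))"
    by (intro continuous_intros)
  ultimately obtain z where z: "z \<in> ?C"
    "\<forall>z'\<in>?C. payoff mu u (fst z') (snd z') \<le> payoff mu u (fst z) (snd z)"
    using continuous_attains_sup by blast
  have "Sup {payoff mu u sig rho | sig rho. P sig rho} = payoff mu u (fst z) (snd z)"
    by (rule cSup_eq_maximum) (use z in auto)
  with z that show ?thesis
    by auto
qed

section \<open>Attainment of the maxima\<close>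

text \<open>Sender always sends one message and Receiver ignores messages, playing an action that is
  best against the prior. This shows at once that all three maximisation problems are
  feasible.\<close>

lemma babbling_cheap_talk_eq:
  fixes mu0 :: "'w::finite \<Rightarrow> real" and uS uR :: "'a::finite \<Rightarrow> 'w \<Rightarrow> real"
  assumes "is_prior mu0"
  obtains sig :: "'w \<Rightarrow> 'm::finite \<Rightarrow> real" and rho
  where "cheap_talk_eq mu0 uS uR sig rho" "partitional sig"
proof -
  \<comment> \<open>Here \<open>undefined\<close> merely names some fixed message.\<close>
  define sig :: "'w \<Rightarrow> 'm \<Rightarrow> real" where "sig w m = of_bool (m = undefined)" for w m
  have msg: "msg_strategy sig"
    by (simp add: msg_strategy_def sig_def)
  let ?v = "interim mu0 uR sig undefined"
  have "Max (range ?v) \<in> range ?v"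
    by (rule Max_in) auto
  then obtain a where "?v a = Max (range ?v)"
    by force
  then have a: "?v b \<le> ?v a" for b
    by simp
  define rho where "rho (m::'m) b = (of_bool (b = a) :: real)" for m b
  have act: "act_strategy rho"
    by (simp add: act_strategy_def rho_def)
  have "interim mu0 uR sig m b \<le> interim mu0 uR sig m a" for m b
    using a[of b] by (cases "m = undefined") (simp_all add: interim_def sig_def)
  then have "R_BR mu0 uR sig rho"
    by (simp add: R_BR_iff[OF act] rho_def)
  moreover have "S_BR mu0 uS sig rho"
    by (simp add: S_BR_iff[OF assms msg] rho_def)
  ultimately have "cheap_talk_eq mu0 uS uR sig rho"
    using msg act by (simp add: cheap_talk_eq_def)
  moreover have "partitional sig"
    by (simp add: partitional_def sig_def)
  ultimately show ?thesis
    by (rule that)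
qed

lemma cheap_talk_eq_imp_persuasion_profile:
  "cheap_talk_eq mu0 uS uR sig rho \<Longrightarrow> persuasion_profile mu0 uR sig rho"
  by (simp add: cheap_talk_eq_def persuasion_profile_def)

lemma closed_persuasion_profiles:
  fixes mu0 :: "'w::finite \<Rightarrow> real" and uR :: "'a::finite \<Rightarrow> 'w \<Rightarrow> real"
  shows "closed {z :: ('w \<Rightarrow> 'm::finite \<Rightarrow> real) \<times> ('m \<Rightarrow> 'a \<Rightarrow> real).
    persuasion_profile mu0 uR (fst z) (snd z)}"
  by (intro closed_Collect_persuasion_profile continuous_intros)

lemma persuasion_payoff_attained:
  fixes mu0 :: "'w::finite \<Rightarrow> real" and uS uR :: "'a::finite \<Rightarrow> 'w \<Rightarrow> real"
  assumes "is_prior mu0"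
  obtains sig :: "'w \<Rightarrow> 'm::finite \<Rightarrow> real" and rho
  where "optimal_persuasion_profile mu0 uS uR sig rho"
    "\<And>(sig' :: 'w \<Rightarrow> 'm \<Rightarrow> real) rho'. persuasion_profile mu0 uR sig' rho' \<Longrightarrow>
       payoff mu0 uS sig' rho' \<le> persuasion_payoff mu0 uS uR TYPE('m)"
proof -
  obtain sig0 :: "'w \<Rightarrow> 'm \<Rightarrow> real" and rho0 where "cheap_talk_eq mu0 uS uR sig0 rho0"
    using babbling_cheap_talk_eq[OF assms] by blast
  then have "persuasion_profile mu0 uR sig0 rho0"
    by (rule cheap_talk_eq_imp_persuasion_profile)
  from payoff_attains_Sup[of "persuasion_profile mu0 uR", OF closed_persuasion_profiles _ this,
      where mu = mu0 and u = uS]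
  obtain sig :: "'w \<Rightarrow> 'm \<Rightarrow> real" and rho where
    "persuasion_profile mu0 uR sig rho"
    "payoff mu0 uS sig rho = persuasion_payoff mu0 uS uR TYPE('m)"
    "\<And>(sig' :: 'w \<Rightarrow> 'm \<Rightarrow> real) rho'. persuasion_profile mu0 uR sig' rho' \<Longrightarrow>
       payoff mu0 uS sig' rho' \<le> payoff mu0 uS sig rho"
    by (auto simp: persuasion_profile_def persuasion_payoff_def)
  then show ?thesis
    using that by (simp add: optimal_persuasion_profile_def)
qed

lemma payoff_le_persuasion_payoff:
  fixes sig :: "'w::finite \<Rightarrow> 'm::finite \<Rightarrow> real"
  assumes "is_prior mu0" "persuasion_profile mu0 uR sig rho"
  shows "payoff mu0 uS sig rho \<le> persuasion_payoff mu0 uS uR TYPE('m)"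
  using persuasion_payoff_attained[OF assms(1), of uS uR] assms(2) by metis

lemma partitional_persuasion_payoff_attained:
  fixes mu0 :: "'w::finite \<Rightarrow> real" and uS uR :: "'a::finite \<Rightarrow> 'w \<Rightarrow> real"
  assumes "is_prior mu0"
  obtains sig :: "'w \<Rightarrow> 'm::finite \<Rightarrow> real" and rho
  where "persuasion_profile mu0 uR sig rho" "partitional sig"
    "payoff mu0 uS sig rho = partitional_persuasion_payoff mu0 uS uR TYPE('m)"
    "\<And>(sig' :: 'w \<Rightarrow> 'm \<Rightarrow> real) rho'. persuasion_profile mu0 uR sig' rho' \<Longrightarrow> partitional sig' \<Longrightarrow>
       payoff mu0 uS sig' rho' \<le> partitional_persuasion_payoff mu0 uS uR TYPE('m)"
proof -
  let ?P = "\<lambda>(sig :: 'w \<Rightarrow> 'm \<Rightarrow> real) rho. persuasion_profile mu0 uR sig rho \<and> partitional sig"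
  obtain sig0 :: "'w \<Rightarrow> 'm \<Rightarrow> real" and rho0 where
    "cheap_talk_eq mu0 uS uR sig0 rho0" "partitional sig0"
    using babbling_cheap_talk_eq[OF assms] by blast
  then have ex: "?P sig0 rho0"
    using cheap_talk_eq_imp_persuasion_profile by blast
  have "closed {z. ?P (fst z) (snd z)}"
    by (intro closed_Collect_conj closed_persuasion_profiles closed_Collect_partitional
        continuous_intros)
  from payoff_attains_Sup[of ?P, OF this _ ex, where mu = mu0 and u = uS]
  obtain sig :: "'w \<Rightarrow> 'm \<Rightarrow> real" and rho where
    "?P sig rho"
    "payoff mu0 uS sig rho = partitional_persuasion_payoff mu0 uS uR TYPE('m)"
    "\<And>(sig' :: 'w \<Rightarrow> 'm \<Rightarrow> real) rho'. ?P sig' rho' \<Longrightarrow>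
       payoff mu0 uS sig' rho' \<le> payoff mu0 uS sig rho"
    by (auto simp: persuasion_profile_def partitional_persuasion_payoff_def)
  then show ?thesis
    using that by auto
qed

lemma cheap_talk_payoff_attained:
  fixes mu0 :: "'w::finite \<Rightarrow> real" and uS uR :: "'a::finite \<Rightarrow> 'w \<Rightarrow> real"
  assumes "is_prior mu0"
  obtains sig :: "'w \<Rightarrow> 'm::finite \<Rightarrow> real" and rho
  where "cheap_talk_eq mu0 uS uR sig rho"
    "payoff mu0 uS sig rho = cheap_talk_payoff mu0 uS uR TYPE('m)"
    "\<And>(sig' :: 'w \<Rightarrow> 'm \<Rightarrow> real) rho'. cheap_talk_eq mu0 uS uR sig' rho' \<Longrightarrow>
       payoff mu0 uS sig' rho' \<le> cheap_talk_payoff mu0 uS uR TYPE('m)"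
proof -
  obtain sig0 :: "'w \<Rightarrow> 'm \<Rightarrow> real" and rho0 where ex: "cheap_talk_eq mu0 uS uR sig0 rho0"
    using babbling_cheap_talk_eq[OF assms] by blast
  have "closed {z :: ('w \<Rightarrow> 'm::finite \<Rightarrow> real) \<times> ('m \<Rightarrow> 'a \<Rightarrow> real).
      cheap_talk_eq mu0 uS uR (fst z) (snd z)}"
    unfolding cheap_talk_eq_def
    by (intro closed_Collect_conj closed_Collect_msg_strategy closed_Collect_act_strategy
        closed_Collect_S_BR closed_Collect_R_BR continuous_intros)
  from payoff_attains_Sup[of "cheap_talk_eq mu0 uS uR", OF this _ ex, where mu = mu0 and u = uS]
  obtain sig :: "'w \<Rightarrow> 'm \<Rightarrow> real" and rho where
    "cheap_talk_eq mu0 uS uR sig rho"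
    "payoff mu0 uS sig rho = cheap_talk_payoff mu0 uS uR TYPE('m)"
    "\<And>(sig' :: 'w \<Rightarrow> 'm \<Rightarrow> real) rho'. cheap_talk_eq mu0 uS uR sig' rho' \<Longrightarrow>
       payoff mu0 uS sig' rho' \<le> payoff mu0 uS sig rho"
    by (auto simp: cheap_talk_eq_def cheap_talk_payoff_def)
  then show ?thesis
    using that by auto
qed

section \<open>Unique responses and cheap talk\<close>

lemma interim_unused:
  assumes "msg_strategy sig" "m \<notin> used_messages sig"
  shows "interim mu0 u sig m a = 0"
proof -
  have "sig w m = 0" for w
    using assms by (auto simp: msg_strategy_def used_messages_def not_less intro: antisym)
  then show ?thesis
    by (simp add: interim_def)
qed

lemma msg_mass_pos:
  fixes mu0 :: "'w::finite \<Rightarrow> real"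
  assumes "is_prior mu0" "msg_strategy sig" "m \<in> used_messages sig"
  shows "(\<Sum>w\<in>UNIV. mu0 w * sig w m) > 0"
proof -
  obtain w where "sig w m > 0"
    using assms(3) by (auto simp: used_messages_def)
  then show ?thesis
    using assms(1,2) by (intro sum_pos2[where i = w])
      (auto simp: is_prior_def msg_strategy_def intro: less_imp_le mult_nonneg_nonneg)
qed

text \<open>Posterior expected utility is \<open>interim\<close> divided by the probability of the
  message, which is positive at used messages. The link lets statement (iii) be handled without
  normalisation.\<close>

lemma argmax_posterior_eq_argmax_interim:
  fixes mu0 :: "'w::finite \<Rightarrow> real"
  assumes "is_prior mu0" "msg_strategy sig" "m \<in> used_messages sig"
  shows "argmax_set (\<lambda>a. \<Sum>w\<in>UNIV. posterior mu0 sig m w * u a w) = argmax_set (interim mu0 u sig m)"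
proof -
  have "(\<Sum>w\<in>UNIV. posterior mu0 sig m w * u a w)
      = interim mu0 u sig m a / (\<Sum>w\<in>UNIV. mu0 w * sig w m)" for a
    by (simp add: posterior_def interim_def sum_divide_distrib)
  then show ?thesis
    using msg_mass_pos[OF assms] by (simp add: argmax_set_def divide_le_cancel)
qed

lemma argmax_set_eqD:
  fixes f :: "'a::finite \<Rightarrow> real"
  assumes "\<not> card (argmax_set f) \<ge> 2" "a \<in> argmax_set f" "b \<in> argmax_set f"
  shows "a = b"
proof (rule ccontr)
  assume "a \<noteq> b"
  then have "card {a, b} = 2"
    by simp
  moreover have "card {a, b} \<le> card (argmax_set f)"
    using assms(2,3) by (intro card_mono) auto
  ultimately show False
    using assms(1) by simp
qed

lemma act_strategy_pure:
  fixes rho :: "'m::finite \<Rightarrow> 'a::finite \<Rightarrow> real"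
  assumes "act_strategy rho" "\<And>b. rho m b > 0 \<Longrightarrow> b = a"
  shows "rho m = (\<lambda>b. of_bool (b = a))"
proof -
  have z: "rho m b = 0" if "b \<noteq> a" for b
    using assms that by (metis act_strategy_def order_le_less)
  have "1 = (\<Sum>b\<in>UNIV. rho m b)"
    using assms(1) by (simp add: act_strategy_def)
  also have "\<dots> = (\<Sum>b\<in>{a}. rho m b)"
    by (rule sum.mono_neutral_right) (use z in auto)
  finally show ?thesis
    using z by (auto simp: fun_eq_iff)
qed

lemma act_strategy_ex_pos:
  fixes rho :: "'m::finite \<Rightarrow> 'a::finite \<Rightarrow> real"
  assumes "act_strategy rho"
  shows "\<exists>a. rho m a > 0"
  using assms unfolding act_strategy_def by (metis order_le_less sum.neutral zero_neq_one)

lemma msg_strategy_ex_pos: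
  fixes sig :: "'w::finite \<Rightarrow> 'm::finite \<Rightarrow> real"
  assumes "msg_strategy sig"
  shows "\<exists>m. sig w m > 0"
  using assms unfolding msg_strategy_def by (metis order_le_less sum.neutral zero_neq_one)

lemma payoff_diff_msg:
  "payoff mu0 u sig' rho - payoff mu0 u sig rho =
     (\<Sum>w\<in>UNIV. \<Sum>m\<in>UNIV. (sig' w m - sig w m) * (mu0 w * (\<Sum>a\<in>UNIV. rho m a * u a w)))"
  unfolding payoff_by_state by (simp add: left_diff_distrib sum_subtractf)

lemma unique_responses_imp_cheap_talk:
  fixes mu0 :: "'w::finite \<Rightarrow> real" and sig :: "'w \<Rightarrow> 'm::finite \<Rightarrow> real"
    and uS uR :: "'a::finite \<Rightarrow> 'w \<Rightarrow> real"
  assumes prior: "is_prior mu0"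
    and opt: "optimal_persuasion_profile mu0 uS uR sig rho"
    and uniq: "\<And>m. m \<in> used_messages sig \<Longrightarrow> \<not> card (argmax_set (interim mu0 uR sig m)) \<ge> 2"
  obtains rho' where "cheap_talk_eq mu0 uS uR sig rho'"
    "payoff mu0 uS sig rho' = payoff mu0 uS sig rho"
proof -
  let ?used = "used_messages sig"
  have msg: "msg_strategy sig" and act: "act_strategy rho"
    and br: "\<And>m a b. rho m a > 0 \<Longrightarrow> interim mu0 uR sig m b \<le> interim mu0 uR sig m a"
    using opt by (auto simp: optimal_persuasion_profile_def persuasion_profile_iff)
  obtain \<alpha> where \<alpha>: "\<And>m. rho m (\<alpha> m) > 0"
    using act_strategy_ex_pos[OF act] by metis
  have strict: "interim mu0 uR sig m b < interim mu0 uR sig m (\<alpha> m)"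
    if "m \<in> ?used" "b \<noteq> \<alpha> m" for m b
  proof (rule ccontr)
    assume "\<not> ?thesis"
    then have "b \<in> argmax_set (interim mu0 uR sig m)" "\<alpha> m \<in> argmax_set (interim mu0 uR sig m)"
      using br[OF \<alpha>[of m]] by (auto simp: argmax_set_def not_less intro: order_trans)
    then show False
      using argmax_set_eqD[OF uniq[OF that(1)]] that(2) by blast
  qed
  have pure: "rho m = (\<lambda>b. of_bool (b = \<alpha> m))" if "m \<in> ?used" for m
    using br strict[OF that] by (intro act_strategy_pure[OF act]) (metis not_le)
  obtain m0 where m0: "m0 \<in> ?used"
    using msg_strategy_ex_pos[OF msg, of undefined] by (auto simp: used_messages_def)
  define rep where "rep m = (if m \<in> ?used then m else m0)" for m
  define rho' where "rho' m = rho (rep m)" for m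
  have rep: "rep m \<in> ?used" for m
    using m0 by (simp add: rep_def)
  have pure': "rho' m b = of_bool (b = \<alpha> (rep m))" for m b
    using pure[OF rep] by (simp add: rho'_def)
  have act': "act_strategy rho'"
    using act by (simp add: act_strategy_def rho'_def)
  have unused: "sig w m = 0" if "m \<notin> ?used" for w m
    using that msg by (auto simp: msg_strategy_def used_messages_def not_less intro: antisym)
  have same: "payoff mu0 uS sig rho' = payoff mu0 uS sig rho"
    unfolding payoff_def
    by (intro sum.cong refl) (auto simp: rho'_def rep_def unused)
  have R: "R_BR mu0 uR sig rho'"
    unfolding R_BR_iff[OF act']
    using br interim_unused[OF msg, of _ mu0 uR] by (auto simp: rho'_def rep_def)
  have S: "S_BR mu0 uS sig rho'"
    unfolding S_BR_iff[OF prior msg]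
  proof (intro allI impI)
    fix w m m'
    assume pos: "sig w m > 0"
    then have m: "m \<in> ?used" "rep m = m"
      by (auto simp: used_messages_def rep_def)
    define n where "n = rep m'"
    have n: "n \<in> ?used" "rep n = n"
      using m0 by (auto simp: n_def rep_def)
    show "(\<Sum>a\<in>UNIV. rho' m' a * uS a w) \<le> (\<Sum>a\<in>UNIV. rho' m a * uS a w)"
    proof (rule ccontr)
      assume "\<not> ?thesis"
      then have gt: "uS (\<alpha> n) w > uS (\<alpha> m) w"
        using m by (simp add: pure' n_def)
      then have "m \<noteq> n"
        by auto
      \<comment> \<open>Shifting a little mass in state w from m to n keeps the strict best responses intact.\<close>
      define sigt where "sigt t w' k = sig w' k + t * (of_bool (w' = w) * (of_bool (k = n) - of_bool (k = m)))"
        for t w' k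
      have int: "interim mu0 uR (sigt t) k b =
          interim mu0 uR sig k b + t * ((of_bool (k = n) - of_bool (k = m)) * (mu0 w * uR b w))" for t k b
      proof -
        have "interim mu0 uR (sigt t) k b = interim mu0 uR sig k b +
          (\<Sum>w'\<in>UNIV. of_bool (w' = w) * (t * ((of_bool (k = n) - of_bool (k = m)) * (mu0 w' * uR b w'))))"
          unfolding interim_def sum.distrib[symmetric]
          by (intro sum.cong refl) (simp add: sigt_def algebra_simps)
        then show ?thesis
          by simp
      qed
      have "\<forall>\<^sub>F t in at_right 0. interim mu0 uR (sigt t) k b < interim mu0 uR (sigt t) k (\<alpha> k)"
        if "k \<in> ?used" "b \<noteq> \<alpha> k" for k b
      proof -
        have lim: "((\<lambda>t. interim mu0 uR (sigt t) k c) \<longlongrightarrow> interim mu0 uR sig k c) (at_right 0)" for c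
          unfolding int by (rule tendsto_eq_intros refl | simp)+
        show ?thesis
          using order_tendstoD(1)[OF tendsto_diff[OF lim lim], of 0 "\<alpha> k" b] strict[OF that]
          by simp
      qed
      \<comment> \<open>Strictness persists for small t at each message and action separately;
        finiteness of both types gives one t for all. The bound \<open>t < sig w m\<close> below
        keeps the reduced probability of m nonnegative.\<close>
      then have "\<forall>\<^sub>F t in at_right 0. \<forall>k b. k \<in> ?used \<longrightarrow> b \<noteq> \<alpha> k \<longrightarrow>
          interim mu0 uR (sigt t) k b < interim mu0 uR (sigt t) k (\<alpha> k)"
        by (intro eventually_all_finite) (auto simp: eventually_mono)
      moreover have "\<forall>\<^sub>F t in at_right 0. t < sig w m"
        using pos by (rule eventually_at_rightI[of 0 _ _, rotated]) auto
      moreover have "\<forall>\<^sub>F t in at_right (0::real). t > 0"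
        by (rule eventually_at_right_less)
      ultimately have "\<forall>\<^sub>F t in at_right 0. t > 0 \<and> t < sig w m \<and> (\<forall>k b. k \<in> ?used \<longrightarrow> b \<noteq> \<alpha> k \<longrightarrow>
          interim mu0 uR (sigt t) k b < interim mu0 uR (sigt t) k (\<alpha> k))"
        by eventually_elim auto
      from eventually_happens'[OF trivial_limit_at_right_real this]
      obtain t where t: "t > 0" "t < sig w m"
        and best: "\<And>k b. k \<in> ?used \<Longrightarrow> b \<noteq> \<alpha> k \<Longrightarrow>
          interim mu0 uR (sigt t) k b < interim mu0 uR (sigt t) k (\<alpha> k)"
        by blast
      have "sigt t w' k \<ge> 0" for w' k
        using msg t by (auto simp: sigt_def msg_strategy_def of_bool_def)
      moreover have "(\<Sum>k\<in>UNIV. sigt t w' k) = 1" for w'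
        using msg by (simp add: sigt_def msg_strategy_def sum.distrib sum_subtractf flip: sum_distrib_left)
      ultimately have msgt: "msg_strategy (sigt t)"
        by (simp add: msg_strategy_def)
      have "interim mu0 uR (sigt t) k b \<le> interim mu0 uR (sigt t) k a" if "rho' k a > 0" for k a b
      proof (cases "k \<in> ?used")
        case True
        then show ?thesis
          using that best[OF True, of b] by (cases "b = \<alpha> k") (auto simp: pure' rep_def)
      next
        case False
        then have "k \<noteq> m" "k \<noteq> n"
          using m n by auto
        then show ?thesis
          using interim_unused[OF msg False, of mu0 uR] by (simp add: int)
      qed
      then have "persuasion_profile mu0 uR (sigt t) rho'"
        using msgt act' by (simp add: persuasion_profile_iff)
      then have "payoff mu0 uS (sigt t) rho' \<le> payoff mu0 uS sig rho'"
        using payoff_le_persuasion_payoff[OF prior] opt same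
        by (metis optimal_persuasion_profile_def)
      \<comment> \<open>Responses are held fixed, so only the moved mass in state w changes the
        payoff, and it gains the utility difference between the two actions.\<close>
      moreover have "payoff mu0 uS (sigt t) rho' - payoff mu0 uS sig rho' =
          t * mu0 w * (uS (\<alpha> n) w - uS (\<alpha> m) w)"
      proof -
        let ?v = "\<lambda>w' k. t * (mu0 w' * uS (\<alpha> (rep k)) w')"
        have v: "(\<Sum>a\<in>UNIV. rho' k a * uS a w') = uS (\<alpha> (rep k)) w'" for k w'
          by (simp add: pure')
        have "payoff mu0 uS (sigt t) rho' - payoff mu0 uS sig rho' =
          (\<Sum>w'\<in>UNIV. of_bool (w' = w) * ((\<Sum>k\<in>UNIV. of_bool (k = n) * ?v w' k) - (\<Sum>k\<in>UNIV. of_bool (k = m) * ?v w' k)))"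
          unfolding payoff_diff_msg sum_subtractf[symmetric] sum_distrib_left v
          by (intro sum.cong refl) (simp add: sigt_def algebra_simps)
        also have "\<dots> = ?v w n - ?v w m"
          by simp
        finally show ?thesis
          by (simp add: m n algebra_simps)
      qed
      moreover have "t * mu0 w * (uS (\<alpha> n) w - uS (\<alpha> m) w) > 0"
        using t gt prior by (simp add: is_prior_def)
      ultimately show False
        by simp
    qed
  qed
  show ?thesis
    by (rule that[OF _ same]) (use msg act' R S in \<open>simp add: cheap_talk_eq_def\<close>)
qed

text \<open>Under a partitional strategy the interim payoff at a used message is a sum over the
  nonempty cell T of states sending it. Two maximisers would give equal sums over T, which
  \<open>distinct\<close> excludes.\<close>

lemma partitional_unique_responses:
  fixes mu0 :: "'w::finite \<Rightarrow> real" and uR :: "'a::finite \<Rightarrow> 'w \<Rightarrow> real"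
  assumes msg: "msg_strategy sig" and part: "partitional sig"
    and used: "m \<in> used_messages sig"
    and distinct: "\<And>T a b. T \<noteq> {} \<Longrightarrow> a \<noteq> b \<Longrightarrow> (\<Sum>w\<in>T. mu0 w * uR a w) \<noteq> (\<Sum>w\<in>T. mu0 w * uR b w)"
  shows "\<not> card (argmax_set (interim mu0 uR sig m)) \<ge> 2"
proof
  assume "card (argmax_set (interim mu0 uR sig m)) \<ge> 2"
  then have "\<not> card (argmax_set (interim mu0 uR sig m)) \<le> Suc 0"
    by simp
  then obtain a b where ab: "a \<in> argmax_set (interim mu0 uR sig m)"
    "b \<in> argmax_set (interim mu0 uR sig m)" "a \<noteq> b"
    by (subst (asm) card_le_Suc0_iff_eq) auto
  \<comment> \<open>One entry of the row equals 1, so the remaining nonnegative entries sum to zero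
    and each vanishes.\<close>
  have zero_one: "sig w k = 0 \<or> sig w k = 1" for w k
  proof -
    obtain l where l: "sig w l = 1"
      using part by (auto simp: partitional_def)
    have nn: "\<And>k. sig w k \<ge> 0" and "(\<Sum>k\<in>UNIV. sig w k) = 1"
      using msg by (auto simp: msg_strategy_def)
    then have "(\<Sum>k\<in>UNIV - {l}. sig w k) = 0"
      using l by (simp add: sum_diff1)
    then show ?thesis
      using l nn by (cases "k = l") (auto simp: sum_nonneg_eq_0_iff)
  qed
  define T where "T = {w. sig w m = 1}"
  have "interim mu0 uR sig m c = (\<Sum>w\<in>T. mu0 w * uR c w)" for c
    unfolding interim_def
    by (rule sum.mono_neutral_cong_right) (use zero_one in \<open>auto simp: T_def\<close>)
  moreover obtain w where "sig w m > 0"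
    using used by (auto simp: used_messages_def)
  then have "T \<noteq> {}"
    using zero_one[of w m] by (auto simp: T_def)
  moreover have "interim mu0 uR sig m a = interim mu0 uR sig m b"
    using ab by (auto simp: argmax_set_def intro: antisym)
  ultimately show False
    using distinct ab(3) by metis
qed

section \<open>Pure responses and pooling\<close>

text \<open>Replacing the mixture at m by any action of its support preserves Receiver's optimality.
  None of these replacements can beat the optimal payoff, yet the mixture averages them, so all are
  optimal. Two different ones would induce different outcomes.\<close>

lemma optimal_response_pure:
  fixes mu0 :: "'w::finite \<Rightarrow> real" and sig :: "'w \<Rightarrow> 'm::finite \<Rightarrow> real"
    and uS uR :: "'a::finite \<Rightarrow> 'w \<Rightarrow> real"
  assumes prior: "is_prior mu0"
    and opt: "optimal_persuasion_profile mu0 uS uR sig rho"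
    and uniq: "\<And>rho1 rho2. optimal_persuasion_profile mu0 uS uR sig rho1 \<Longrightarrow>
      optimal_persuasion_profile mu0 uS uR sig rho2 \<Longrightarrow> outcome mu0 sig rho1 = outcome mu0 sig rho2"
    and used: "m \<in> used_messages sig" and pos: "rho m a > 0" "rho m b > 0"
  shows "a = b"
proof (rule ccontr)
  assume "a \<noteq> b"
  have msg: "msg_strategy sig" and act: "act_strategy rho"
    and br: "\<And>m a b. rho m a > 0 \<Longrightarrow> interim mu0 uR sig m b \<le> interim mu0 uR sig m a"
    and V: "payoff mu0 uS sig rho = persuasion_payoff mu0 uS uR TYPE('m)"
    using opt by (auto simp: optimal_persuasion_profile_def persuasion_profile_iff)
  let ?I = "interim mu0 uS sig m"
  let ?avg = "\<Sum>x\<in>UNIV. rho m x * ?I x"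
  define pureat where "pureat c = rho(m := (\<lambda>x. of_bool (x = c)))" for c
  have prof: "persuasion_profile mu0 uR sig (pureat c)" if "rho m c > 0" for c
    using msg act br that
    by (auto simp: persuasion_profile_iff pureat_def act_strategy_def split: if_splits)
  have pay: "payoff mu0 uS sig (pureat c) = payoff mu0 uS sig rho + (?I c - ?avg)" for c
  proof -
    have "payoff mu0 uS sig r = (\<Sum>x\<in>UNIV. r m x * ?I x) +
        (\<Sum>k\<in>UNIV - {m}. \<Sum>x\<in>UNIV. r k x * interim mu0 uS sig k x)" for r
      unfolding payoff_interim by (rule sum.remove) auto
    then show ?thesis
      by (simp add: pureat_def)
  qed
  have le: "?I c \<le> ?avg" if "rho m c > 0" for c
    using payoff_le_persuasion_payoff[OF prior prof[OF that], of uS] by (simp add: pay V)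
  \<comment> \<open>The weighted gaps below the average are nonnegative and sum to zero, so every
    action in the support attains the average.\<close>
  have "(\<Sum>x\<in>UNIV. rho m x * (?avg - ?I x)) = 0"
    using act by (simp add: act_strategy_def right_diff_distrib sum_subtractf flip: sum_distrib_right)
  moreover have "rho m x * (?avg - ?I x) \<ge> 0" for x
  proof (cases "rho m x = 0")
    case False
    then have "rho m x > 0"
      using act by (simp add: act_strategy_def order_less_le)
    then show ?thesis
      using le[of x] by simp
  qed simp
  ultimately have zero: "rho m x * (?avg - ?I x) = 0" for x
    by (simp add: sum_nonneg_eq_0_iff)
  have "?I c = ?avg" if "rho m c > 0" for c
    using zero[of c] that by simp
  then have opt': "optimal_persuasion_profile mu0 uS uR sig (pureat c)" if "rho m c > 0" for c
    using that prof by (simp add: optimal_persuasion_profile_def pay V)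
  obtain w where w: "sig w m > 0"
    using used by (auto simp: used_messages_def)
  \<comment> \<open>Only the summand of m depends on c: the probability of the pair (a, w) falls by
    \<open>mu0 w * sig w m\<close> when a is replaced by b.\<close>
  have out: "outcome mu0 sig (pureat c) a w = mu0 w * sig w m * of_bool (a = c) +
      (\<Sum>k\<in>UNIV - {m}. mu0 w * sig w k * rho k a)" for c
    unfolding outcome_def by (subst sum.remove[of _ m]) (auto simp: pureat_def)
  have "outcome mu0 sig (pureat a) a w = outcome mu0 sig (pureat b) a w"
    using uniq[OF opt'[OF pos(1)] opt'[OF pos(2)]] by simp
  then have "mu0 w * sig w m = 0"
    using \<open>a \<noteq> b\<close> by (simp only: out) simp
  then show False
    using w prior by (metis is_prior_def less_irrefl mult_eq_0_iff)
qed

text \<open>Sender's optimality makes all messages sent in a state equally good; without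
  indifference they induce the same action. Messages inducing the same action can therefore be
  merged into one, which makes the strategy partitional and leaves each state's action
  unchanged.\<close>

lemma pure_cheap_talk_imp_partitional:
  fixes mu0 :: "'w::finite \<Rightarrow> real" and sig :: "'w \<Rightarrow> 'm::finite \<Rightarrow> real"
    and uS uR :: "'a::finite \<Rightarrow> 'w \<Rightarrow> real"
  assumes prior: "is_prior mu0"
    and eq: "cheap_talk_eq mu0 uS uR sig rho"
    and pure: "\<And>m a b. m \<in> used_messages sig \<Longrightarrow> rho m a > 0 \<Longrightarrow> rho m b > 0 \<Longrightarrow> a = b"
    and inj: "\<And>w. inj (\<lambda>a. uS a w)"
  obtains sig' :: "'w \<Rightarrow> 'm \<Rightarrow> real"
  where "persuasion_profile mu0 uR sig' rho" "partitional sig'"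
    "payoff mu0 uS sig' rho = payoff mu0 uS sig rho"
proof -
  let ?used = "used_messages sig"
  have msg: "msg_strategy sig" and act: "act_strategy rho"
    and sbr: "\<And>w m m'. sig w m > 0 \<Longrightarrow>
       (\<Sum>a\<in>UNIV. rho m' a * uS a w) \<le> (\<Sum>a\<in>UNIV. rho m a * uS a w)"
    using eq S_BR_iff[OF prior, of sig uS rho] by (auto simp: cheap_talk_eq_def)
  have br: "\<And>m a b. rho m a > 0 \<Longrightarrow> interim mu0 uR sig m b \<le> interim mu0 uR sig m a"
    using cheap_talk_eq_imp_persuasion_profile[OF eq] by (simp add: persuasion_profile_iff)
  obtain \<alpha> where \<alpha>: "\<And>m. rho m (\<alpha> m) > 0"
    using act_strategy_ex_pos[OF act] by metis
  have rho: "rho m = (\<lambda>b. of_bool (b = \<alpha> m))" if "m \<in> ?used" for m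
    using pure[OF that] \<alpha> by (intro act_strategy_pure[OF act]) blast
  obtain \<mu> where \<mu>: "\<And>w. sig w (\<mu> w) > 0"
    using msg_strategy_ex_pos[OF msg] by metis
  define \<beta> where "\<beta> w = \<alpha> (\<mu> w)" for w
  have used: "m \<in> ?used" if "sig w m > 0" for w m
    using that by (auto simp: used_messages_def)
  \<comment> \<open>Two messages sent in state w must each be at least as good as the other, and
    injectivity turns equal utilities into equal actions.\<close>
  have \<beta>: "\<alpha> m = \<beta> w" if "sig w m > 0" for w m
  proof -
    have "uS (\<alpha> m) w = uS (\<beta> w) w"
      using sbr[OF that, of "\<mu> w"] sbr[OF \<mu>[of w], of m]
      by (simp add: rho[OF used[OF that]] rho[OF used[OF \<mu>]] \<beta>_def)
    then show ?thesis
      using inj by (simp add: inj_def)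
  qed
  \<comment> \<open>One used message is chosen for each action. The choice matters only at actions
    \<open>\<beta> w\<close>, where \<open>\<mu> w\<close> witnesses that such a message
    exists.\<close>
  define rep where "rep a = (SOME m. m \<in> ?used \<and> \<alpha> m = a)" for a
  have rep: "rep (\<beta> w) \<in> ?used" "\<alpha> (rep (\<beta> w)) = \<beta> w" for w
  proof -
    have "\<mu> w \<in> ?used \<and> \<alpha> (\<mu> w) = \<beta> w"
      using used[OF \<mu>] by (simp add: \<beta>_def)
    then have "rep (\<beta> w) \<in> ?used \<and> \<alpha> (rep (\<beta> w)) = \<beta> w"
      unfolding rep_def by (rule someI)
    then show "rep (\<beta> w) \<in> ?used" "\<alpha> (rep (\<beta> w)) = \<beta> w"
      by auto
  qed
  define sig' where "sig' w m = (of_bool (m = rep (\<beta> w)) :: real)" for w m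
  have msg': "msg_strategy sig'"
    by (simp add: msg_strategy_def sig'_def)
  have part: "partitional sig'"
    by (auto simp: partitional_def sig'_def)
  have "interim mu0 uR sig' m b \<le> interim mu0 uR sig' m a" if a: "rho m a > 0" for m a b
  proof (cases "\<exists>w. m = rep (\<beta> w)")
    case True
    then have "m \<in> ?used" and am: "\<alpha> m = a"
      using rep rho a by auto
    have m_iff: "m = rep (\<beta> w) \<longleftrightarrow> \<beta> w = a" for w
      using True rep am by metis
    \<comment> \<open>Merging messages adds their interim payoffs. Since a is a best response to
      every merged message, it is a best response to the sum.\<close>
    have pooled: "interim mu0 uR sig' m c = (\<Sum>k | k \<in> ?used \<and> \<alpha> k = a. interim mu0 uR sig k c)" for c
    proof -
      have "interim mu0 uR sig' m c = (\<Sum>w\<in>UNIV. \<Sum>k | k \<in> ?used \<and> \<alpha> k = a. mu0 w * sig w k * uR c w)"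
        unfolding interim_def
      proof (rule sum.cong[OF refl])
        fix w
        have pos: "sig w k > 0" if "sig w k \<noteq> 0" for k
          using msg that by (simp add: msg_strategy_def order_less_le)
        have one: "(\<Sum>k\<in>UNIV. sig w k) = 1"
          using msg by (simp add: msg_strategy_def)
        have "(\<Sum>k | k \<in> ?used \<and> \<alpha> k = a. sig w k) = sig' w m"
        proof (cases "\<beta> w = a")
          case True
          have "(\<Sum>k | k \<in> ?used \<and> \<alpha> k = a. sig w k) = (\<Sum>k\<in>UNIV. sig w k)"
            by (rule sum.mono_neutral_left)
              (use True used[OF pos] \<beta>[OF pos] in auto)
          then show ?thesis
            using True one m_iff[of w] by (simp add: sig'_def)
        next
          case False
          then have "(\<Sum>k | k \<in> ?used \<and> \<alpha> k = a. sig w k) = 0"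
            using \<beta>[OF pos] by (intro sum.neutral) fastforce
          then show ?thesis
            using False m_iff[of w] by (simp add: sig'_def)
        qed
        then show "mu0 w * sig' w m * uR c w = (\<Sum>k | k \<in> ?used \<and> \<alpha> k = a. mu0 w * sig w k * uR c w)"
          by (simp flip: sum_distrib_left sum_distrib_right)
      qed
      then show ?thesis
        unfolding interim_def by (simp add: sum.swap[of _ _ UNIV])
    qed
    show ?thesis
      unfolding pooled by (rule sum_mono) (use br \<alpha> in auto)
  next
    case False
    then show ?thesis
      by (simp add: interim_def sig'_def)
  qed
  then have "persuasion_profile mu0 uR sig' rho"
    using msg' act by (simp add: persuasion_profile_iff)
  moreover have "payoff mu0 uS sig' rho = payoff mu0 uS sig rho"
    unfolding payoff_by_state
  proof (rule sum.cong[OF refl])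
    fix w
    let ?v = "\<lambda>m. mu0 w * (\<Sum>a\<in>UNIV. rho m a * uS a w)"
    have "(\<Sum>m\<in>UNIV. sig' w m * ?v m) = mu0 w * uS (\<beta> w) w"
      by (rule sum_weights_const_on_support)
        (use msg' rep in \<open>auto simp: msg_strategy_def sig'_def rho\<close>)
    also have "\<dots> = (\<Sum>m\<in>UNIV. sig w m * ?v m)"
      by (rule sum_weights_const_on_support[symmetric])
        (use msg used \<beta> in \<open>auto simp: msg_strategy_def rho\<close>)
    finally show "(\<Sum>m\<in>UNIV. sig' w m * ?v m) = (\<Sum>m\<in>UNIV. sig w m * ?v m)" .
  qed
  ultimately show ?thesis
    using part by (intro that)
qed

section \<open>Genericity\<close>

lemma sets_env_lebesgue: "sets env_lebesgue = sets borel"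
proof -
  have "sets (env_lebesgue :: (bool \<times> 'a \<times> 'b \<Rightarrow> real) measure) = sets (PiM UNIV (\<lambda>_. borel))"
    by (rule sets_PiM_cong) auto
  then show ?thesis
    by (simp add: sets_PiM_equal_borel)
qed

text \<open>Because the maximum is attained, a superlevel set is the projection of a closed set
  along the compact space of profiles, hence closed. The persuasion payoff is thus upper
  semicontinuous in the environment.\<close>

lemma borel_measurable_persuasion_payoff:
  fixes mu0 :: "'w::finite \<Rightarrow> real"
  assumes prior: "is_prior mu0"
  shows "(\<lambda>e :: bool \<times> 'a::finite \<times> 'w \<Rightarrow> real.
    persuasion_payoff mu0 (envS e) (envR e) TYPE('m::finite)) \<in> borel_measurable borel"
  unfolding borel_measurable_iff_ge
proof
  fix c :: real
  let ?T = "{p :: (('w \<Rightarrow> 'm \<Rightarrow> real) \<times> ('m \<Rightarrow> 'a \<Rightarrow> real)) \<times> (bool \<times> 'a \<times> 'w \<Rightarrow> real).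
    persuasion_profile mu0 (envR (snd p)) (fst (fst p)) (snd (fst p)) \<and>
    c \<le> payoff mu0 (envS (snd p)) (fst (fst p)) (snd (fst p))}"
  have "c \<le> persuasion_payoff mu0 (envS e) (envR e) TYPE('m) \<longleftrightarrow>
      (\<exists>z\<in>strategy_profiles. (z, e) \<in> ?T)" for e :: "bool \<times> 'a \<times> 'w \<Rightarrow> real"
  proof
    assume le: "c \<le> persuasion_payoff mu0 (envS e) (envR e) TYPE('m)"
    obtain sig :: "'w \<Rightarrow> 'm \<Rightarrow> real" and rho where
      "optimal_persuasion_profile mu0 (envS e) (envR e) sig rho"
      using persuasion_payoff_attained[OF prior] by blast
    then show "\<exists>z\<in>strategy_profiles. (z, e) \<in> ?T"
      using le by (intro bexI[of _ "(sig, rho)"])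
        (auto simp: optimal_persuasion_profile_def persuasion_profile_def strategy_profiles_def)
  next
    assume "\<exists>z\<in>strategy_profiles. (z, e) \<in> ?T"
    then show "c \<le> persuasion_payoff mu0 (envS e) (envR e) TYPE('m)"
      using payoff_le_persuasion_payoff[OF prior] by (fastforce intro: order_trans)
  qed
  moreover have "closed {e. \<exists>z\<in>strategy_profiles. (z, e) \<in> ?T}"
    by (intro closed_projection_compact compact_strategy_profiles closed_Collect_conj
        closed_Collect_persuasion_profile closed_Collect_le continuous_intros)
  then have "{e. \<exists>z\<in>strategy_profiles. (z, e) \<in> ?T} \<in> sets borel"
    by (rule borel_closed)
  ultimately show "{e \<in> space (borel :: (bool \<times> 'a \<times> 'w \<Rightarrow> real) measure).
      c \<le> persuasion_payoff mu0 (envS e) (envR e) TYPE('m)} \<in> sets borel"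
    by simp
qed

text \<open>Replaces an equation by the one inequality that is not automatic, so that optimality
  becomes a closed condition once the value is treated as a variable.\<close>

lemma optimal_iff_ge:
  fixes sig :: "'w::finite \<Rightarrow> 'm::finite \<Rightarrow> real"
  assumes "is_prior mu0"
  shows "optimal_persuasion_profile mu0 uS uR sig rho \<longleftrightarrow> persuasion_profile mu0 uR sig rho \<and>
    persuasion_payoff mu0 uS uR TYPE('m) \<le> payoff mu0 uS sig rho"
  using payoff_le_persuasion_payoff[OF assms, of uR sig rho uS]
  by (auto simp: optimal_persuasion_profile_def)

text \<open>The persuasion payoff is only known to be measurable, so its value is first made an
  independent real coordinate. The resulting set is a closed projection, and its preimage under the
  measurable map \<open>e\<close> to \<open>(e, ?h e)\<close> is the required set.\<close>

lemma sets_borel_optimal_in_closed: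
  fixes mu0 :: "'w::finite \<Rightarrow> real"
    and C :: "(('w \<Rightarrow> 'm::finite \<Rightarrow> real) \<times> ('m \<Rightarrow> 'a::finite \<Rightarrow> real)) set"
  assumes prior: "is_prior mu0" and C: "closed C"
  shows "{e. \<exists>z\<in>C. optimal_persuasion_profile mu0 (envS e) (envR e) (fst z) (snd z)} \<in> sets borel"
proof -
  let ?h = "\<lambda>e. persuasion_payoff mu0 (envS e) (envR e) TYPE('m)"
  let ?T = "{p :: (('w \<Rightarrow> 'm \<Rightarrow> real) \<times> ('m \<Rightarrow> 'a \<Rightarrow> real)) \<times> ((bool \<times> 'a \<times> 'w \<Rightarrow> real) \<times> real).
    persuasion_profile mu0 (envR (fst (snd p))) (fst (fst p)) (snd (fst p)) \<and>
    snd (snd p) \<le> payoff mu0 (envS (fst (snd p))) (fst (fst p)) (snd (fst p)) \<and> fst p \<in> C}"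
  let ?D = "{y. \<exists>z\<in>strategy_profiles. (z, y) \<in> ?T}"
  have "closed {p :: (('w \<Rightarrow> 'm \<Rightarrow> real) \<times> ('m \<Rightarrow> 'a \<Rightarrow> real)) \<times> ((bool \<times> 'a \<times> 'w \<Rightarrow> real) \<times> real). fst p \<in> C}"
    using closed_vimage_fst[OF C] by (simp add: vimage_def)
  then have "closed ?D"
    by (intro closed_projection_compact compact_strategy_profiles closed_Collect_conj
        closed_Collect_persuasion_profile closed_Collect_le continuous_intros)
  then have "?D \<in> sets borel"
    by simp
  moreover have "(\<lambda>e. (e, ?h e)) \<in> borel_measurable borel"
    by (intro borel_measurable_Pair borel_measurable_persuasion_payoff prior) simp
  ultimately have "(\<lambda>e. (e, ?h e)) -` ?D \<inter> space borel \<in> sets borel"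
    by (rule measurable_sets[rotated])
  moreover have "(\<lambda>e. (e, ?h e)) -` ?D \<inter> space borel =
    {e. \<exists>z\<in>C. optimal_persuasion_profile mu0 (envS e) (envR e) (fst z) (snd z)}"
    unfolding optimal_iff_ge[OF prior] strategy_profiles_def persuasion_profile_def by force
  ultimately show ?thesis
    by simp
qed

text \<open>In the form of \<open>payoff_outcome\<close> only the term of (a, w) changes. This
  affine dependence supplies the monotonicity used in \<open>AE_unique_outcome\<close>.\<close>

lemma payoff_update_coordinate:
  "payoff mu0 (envS (e((True, a, w) := t))) sig rho =
   payoff mu0 (envS (e((True, a, w) := s))) sig rho + (t - s) * outcome mu0 sig rho a w"
proof -
  have env: "envS (e((True, a, w) := t)) b v = envS (e((True, a, w) := s)) b v
      + (t - s) * (of_bool (b = a) * of_bool (v = w))" for b v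
    by (simp add: envS_def)
  have "(\<Sum>b\<in>UNIV. \<Sum>v\<in>UNIV. outcome mu0 sig rho b v * ((t - s) * (of_bool (b = a) * of_bool (v = w))))
     = (\<Sum>b\<in>UNIV. of_bool (b = a) * (\<Sum>v\<in>UNIV. of_bool (v = w) * ((t - s) * outcome mu0 sig rho b v)))"
    unfolding sum_distrib_left by (intro sum.cong refl) simp
  also have "\<dots> = (t - s) * outcome mu0 sig rho a w"
    by simp
  finally show ?thesis
    by (simp add: payoff_outcome env distrib_left sum.distrib)
qed

text \<open>As \<open>u_S(a, w)\<close> increases, optimal profiles cannot put less probability on
  (a, w). Two optimal profiles separated by a fixed gap can therefore occur at no more than one
  point of each line in that direction.\<close>

lemma AE_unique_outcome:
  fixes mu0 :: "'w::finite \<Rightarrow> real"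
  assumes prior: "is_prior mu0"
  shows "AE e in (env_lebesgue :: (bool \<times> 'a::finite \<times> 'w \<Rightarrow> real) measure).
    \<forall>(sig1 :: 'w \<Rightarrow> 'm::finite \<Rightarrow> real) rho1 (sig2 :: 'w \<Rightarrow> 'm \<Rightarrow> real) rho2.
      optimal_persuasion_profile mu0 (envS e) (envR e) sig1 rho1 \<longrightarrow>
      optimal_persuasion_profile mu0 (envS e) (envR e) sig2 rho2 \<longrightarrow>
      outcome mu0 sig1 rho1 = outcome mu0 sig2 rho2"
proof -
  let ?opt = "\<lambda>e. \<lambda>z :: ('w \<Rightarrow> 'm \<Rightarrow> real) \<times> ('m \<Rightarrow> 'a \<Rightarrow> real).
    optimal_persuasion_profile mu0 (envS e) (envR e) (fst z) (snd z)"
  let ?out = "\<lambda>z :: ('w \<Rightarrow> 'm \<Rightarrow> real) \<times> ('m \<Rightarrow> 'a \<Rightarrow> real). outcome mu0 (fst z) (snd z)"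
  \<comment> \<open>These environments have two optimal profiles separated by the gap between q and
    r. The weak inequalities define closed sets of profiles, which gives measurability.\<close>
  define N where "N a w q r = {e. \<exists>z\<in>{z. ?out z a w \<le> q}. ?opt e z} \<inter> {e. \<exists>z\<in>{z. r \<le> ?out z a w}. ?opt e z}"
    for a w q r
  have null: "N a w q r \<in> null_sets env_lebesgue" if "q < r" for a w q r
  proof (rule PiM_lborel_null_set_by_slices[of _ "(True, a, w)"])
    show "N a w q r \<in> sets env_lebesgue"
      unfolding sets_env_lebesgue N_def
      by (intro sets.Int sets_borel_optimal_in_closed[OF prior] closed_Collect_le continuous_intros)
  next
    fix x :: "bool \<times> 'a \<times> 'w \<Rightarrow> real" and s t
    let ?e = "\<lambda>t. x((True, a, w) := t)"
    \<comment> \<open>Membership in N provides both a high and a low profile at each point, so the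
      high one may be taken at the smaller coordinate s and the low one at t.\<close>
    have no_less: False if less: "s < t" and s: "?e s \<in> N a w q r" and t: "?e t \<in> N a w q r" for s t
    proof -
      \<comment> \<open>Receiver's utilities do not move along this line, so the same persuasion
        profiles are feasible at both points and each optimum can be compared with the
        other.\<close>
      have envR: "envR (?e s) = envR (?e t)"
        by (simp add: envR_def fun_eq_iff)
      obtain y where y: "?opt (?e s) y" "r \<le> ?out y a w"
        using s by (auto simp: N_def)
      obtain z where z: "?opt (?e t) z" "?out z a w \<le> q"
        using t by (auto simp: N_def)
      have "payoff mu0 (envS (?e s)) (fst z) (snd z) \<le> payoff mu0 (envS (?e s)) (fst y) (snd y)"
        using y(1) z(1) payoff_le_persuasion_payoff[OF prior, of "envR (?e s)" "fst z" "snd z"]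
        by (simp add: optimal_persuasion_profile_def envR)
      moreover have "payoff mu0 (envS (?e t)) (fst y) (snd y) \<le> payoff mu0 (envS (?e t)) (fst z) (snd z)"
        using y(1) z(1) payoff_le_persuasion_payoff[OF prior, of "envR (?e t)" "fst y" "snd y"]
        by (simp add: optimal_persuasion_profile_def envR)
      \<comment> \<open>Adding the two optimality inequalities cancels the payoffs at s and leaves
        only the slopes.\<close>
      ultimately have "(t - s) * ?out y a w \<le> (t - s) * ?out z a w"
        by (simp add: payoff_update_coordinate[of _ _ _ _ t _ _ s])
      then show False
        using less y(2) z(2) \<open>q < r\<close> by simp
    qed
    assume "?e s \<in> N a w q r" "?e t \<in> N a w q r"
    then show "s = t"
      using no_less by (metis linorder_neqE)
  qed
  \<comment> \<open>Any two different outcome probabilities are separated by rationals q < r, so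
    countably many null sets suffice.\<close>
  have "AE e in env_lebesgue. \<forall>a w. \<forall>q\<in>\<rat>. \<forall>r\<in>\<rat>. q < r \<longrightarrow> e \<notin> N a w q r"
    unfolding AE_all_countable AE_ball_countable[OF countable_rat]
    using null by (auto intro: AE_not_in)
  then show ?thesis
  proof (rule AE_mp, intro AE_I2 impI allI)
    fix e :: "bool \<times> 'a \<times> 'w \<Rightarrow> real" and sig1 sig2 :: "'w \<Rightarrow> 'm \<Rightarrow> real" and rho1 rho2
    assume notin: "\<forall>a w. \<forall>q\<in>\<rat>. \<forall>r\<in>\<rat>. q < r \<longrightarrow> e \<notin> N a w q r"
      and opt: "optimal_persuasion_profile mu0 (envS e) (envR e) sig1 rho1"
        "optimal_persuasion_profile mu0 (envS e) (envR e) sig2 rho2"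
    have le: "outcome mu0 sig rho a w \<le> outcome mu0 sig' rho' a w"
      if "optimal_persuasion_profile mu0 (envS e) (envR e) sig rho"
        "optimal_persuasion_profile mu0 (envS e) (envR e) sig' rho'"
      for sig sig' :: "'w \<Rightarrow> 'm \<Rightarrow> real" and rho rho' a w
    proof (rule ccontr)
      assume "\<not> ?thesis"
      then obtain q r where "q \<in> \<rat>" "r \<in> \<rat>" "q < r"
        "outcome mu0 sig' rho' a w < q" "r < outcome mu0 sig rho a w"
        by (metis Rats_dense_in_real not_le)
      moreover from this have "e \<in> N a w q r"
        unfolding N_def using that
        by (intro IntI CollectI bexI[of _ "(sig', rho')"] bexI[of _ "(sig, rho)"]) auto
      ultimately show False
        using notin by blast
    qed
    show "outcome mu0 sig1 rho1 = outcome mu0 sig2 rho2"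
      using le[OF opt] le[OF opt(2,1)] by (intro ext antisym)
  qed
qed

text \<open>Once all other coordinates are fixed, a tie determines \<open>u_S(a, w)\<close>, so each
  tie set is null; there are finitely many of them.\<close>

lemma AE_envS_inj:
  "AE e in (env_lebesgue :: (bool \<times> 'a::finite \<times> 'w::finite \<Rightarrow> real) measure).
    \<forall>w. inj (\<lambda>a. envS e a w)"
proof -
  have "AE e in (env_lebesgue :: (bool \<times> 'a::finite \<times> 'w::finite \<Rightarrow> real) measure).
      envS e a w \<noteq> envS e b w" if "a \<noteq> b" for a b w
  proof -
    have "{e :: bool \<times> 'a \<times> 'w \<Rightarrow> real. envS e a w = envS e b w} \<in> null_sets env_lebesgue"
    proof (rule PiM_lborel_null_set_by_slices[of _ "(True, a, w)"])
      have "closed {e :: bool \<times> 'a \<times> 'w \<Rightarrow> real. envS e a w = envS e b w}"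
        unfolding envS_def by (intro closed_Collect_eq continuous_on_product_coordinates)
      then show "{e :: bool \<times> 'a \<times> 'w \<Rightarrow> real. envS e a w = envS e b w} \<in> sets env_lebesgue"
        unfolding sets_env_lebesgue by (rule borel_closed)
    qed (use that in \<open>auto simp: envS_def\<close>)
    from AE_not_in[OF this] show ?thesis
      by simp
  qed
  then have "AE e in (env_lebesgue :: (bool \<times> 'a::finite \<times> 'w::finite \<Rightarrow> real) measure).
      \<forall>w a b. a \<noteq> b \<longrightarrow> envS e a w \<noteq> envS e b w"
    unfolding AE_all_countable by auto
  then show ?thesis
    by (rule AE_mp) (intro AE_I2, auto simp: inj_def)
qed

text \<open>For v in T, a tie determines the coordinate \<open>u_R(a, v)\<close>, whose coefficient
  \<open>mu0 v\<close> is positive. Up to normalisation, the sums are Receiver's expected utilities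
  given that the state lies in T.\<close>

lemma AE_partial_sums_distinct:
  fixes mu0 :: "'w::finite \<Rightarrow> real"
  assumes "is_prior mu0"
  shows "AE e in (env_lebesgue :: (bool \<times> 'a::finite \<times> 'w \<Rightarrow> real) measure).
    \<forall>T a b. T \<noteq> {} \<longrightarrow> a \<noteq> b \<longrightarrow> (\<Sum>w\<in>T. mu0 w * envR e a w) \<noteq> (\<Sum>w\<in>T. mu0 w * envR e b w)"
proof -
  have "AE e in (env_lebesgue :: (bool \<times> 'a::finite \<times> 'w::finite \<Rightarrow> real) measure).
      (\<Sum>w\<in>T. mu0 w * envR e a w) \<noteq> (\<Sum>w\<in>T. mu0 w * envR e b w)" if "v \<in> T" "a \<noteq> b" for T v a b
  proof -
    let ?N = "{e :: bool \<times> 'a \<times> 'w \<Rightarrow> real. (\<Sum>w\<in>T. mu0 w * envR e a w) = (\<Sum>w\<in>T. mu0 w * envR e b w)}"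
    have "?N \<in> null_sets env_lebesgue"
    proof (rule PiM_lborel_null_set_by_slices[of _ "(False, a, v)"])
      have "closed ?N"
        unfolding envR_def
        by (intro closed_Collect_eq continuous_intros continuous_on_product_coordinates)
      then show "?N \<in> sets env_lebesgue"
        unfolding sets_env_lebesgue by (rule borel_closed)
    next
      fix x :: "bool \<times> 'a \<times> 'w \<Rightarrow> real" and s t
      have eq: "(\<Sum>w\<in>T. mu0 w * envR (x((False, a, v) := t)) a w) =
          mu0 v * t + (\<Sum>w\<in>T - {v}. mu0 w * envR x a w)" for t
        using that(1) by (subst sum.remove[of _ v]) (auto simp: envR_def)
      have "(\<Sum>w\<in>T. mu0 w * envR (x((False, a, v) := t)) b w) = (\<Sum>w\<in>T. mu0 w * envR x b w)" for t
        using that(2) by (simp add: envR_def)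
      moreover assume "x((False, a, v) := s) \<in> ?N" "x((False, a, v) := t) \<in> ?N"
      ultimately have "mu0 v * s = mu0 v * t"
        unfolding mem_Collect_eq eq by (metis add_right_cancel)
      then show "s = t"
        using assms by (metis is_prior_def less_irrefl mult_left_cancel)
    qed
    from AE_not_in[OF this] show ?thesis
      by simp
  qed
  then show ?thesis
    unfolding AE_all_countable by (auto simp: ex_in_conv[symmetric])
qed

section \<open>Restriction to the unit cube and the final equivalences\<close>

lemma env_cube_eq_PiE: "env_cube = (\<Pi>\<^sub>E i\<in>UNIV. {0..1})"
  by (auto simp: env_cube_def)

lemma sets_env_cube: "env_cube \<in> sets env_lebesgue"
  unfolding env_cube_eq_PiE by (intro sets_PiM_I_finite) auto

lemma emeasure_env_cube:
  "emeasure (env_lebesgue :: (bool \<times> 'a::finite \<times> 'w::finite \<Rightarrow> real) measure) env_cube = 1"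
proof -
  interpret product_sigma_finite "\<lambda>_ :: bool \<times> 'a \<times> 'w. lborel :: real measure"
    by unfold_locales
  show ?thesis
    unfolding env_cube_eq_PiE by (subst emeasure_PiM) auto
qed

text \<open>The set where P holds need not be measurable, so E is taken as the cube minus a
  measurable null set covering the exceptions.\<close>

lemma AE_imp_full_measure_subset_env_cube:
  fixes P :: "(bool \<times> 'a::finite \<times> 'w::finite \<Rightarrow> real) \<Rightarrow> bool"
  assumes "AE e in env_lebesgue. P e"
  shows "\<exists>E. E \<subseteq> env_cube \<and> E \<in> sets env_lebesgue \<and> emeasure env_lebesgue E = 1 \<and> (\<forall>e\<in>E. P e)"
proof -
  obtain N where N: "N \<in> null_sets env_lebesgue" and P: "{e \<in> space env_lebesgue. \<not> P e} \<subseteq> N"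
    using assms unfolding eventually_ae_filter by blast
  have "P e" if "e \<in> env_cube - N" for e
    using P that by (auto simp: space_PiM)
  moreover have "env_cube - N \<in> sets env_lebesgue"
    using N sets_env_cube by blast
  moreover have "emeasure env_lebesgue (env_cube - N) = 1"
    using emeasure_Diff_null_set[OF N sets_env_cube] by (simp add: emeasure_env_cube)
  ultimately show ?thesis
    by blast
qed

text \<open>The environment is fixed here and the generic properties are hypotheses. The negations
  form a cycle: no value of randomization gives an optimal profile with unique responses, this gives
  no value of commitment, and that gives no value of randomization.\<close>

lemma commitment_randomization_equivalences:
  fixes mu0 :: "'w::finite \<Rightarrow> real" and uS uR :: "'a::finite \<Rightarrow> 'w \<Rightarrow> real"
  assumes prior: "is_prior mu0"
    and uniq: "\<And>(sig1 :: 'w \<Rightarrow> 'm::finite \<Rightarrow> real) rho1 (sig2 :: 'w \<Rightarrow> 'm \<Rightarrow> real) rho2.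
      optimal_persuasion_profile mu0 uS uR sig1 rho1 \<Longrightarrow>
      optimal_persuasion_profile mu0 uS uR sig2 rho2 \<Longrightarrow>
      outcome mu0 sig1 rho1 = outcome mu0 sig2 rho2"
    and inj: "\<And>w. inj (\<lambda>a. uS a w)"
    and distinct: "\<And>T a b. T \<noteq> {} \<Longrightarrow> a \<noteq> b \<Longrightarrow> (\<Sum>w\<in>T. mu0 w * uR a w) \<noteq> (\<Sum>w\<in>T. mu0 w * uR b w)"
  shows "commitment_valuable mu0 uS uR TYPE('m) \<longleftrightarrow> values_randomization mu0 uS uR TYPE('m)"
    and "values_randomization mu0 uS uR TYPE('m) \<longleftrightarrow>
      (\<forall>(sig :: 'w \<Rightarrow> 'm \<Rightarrow> real) rho. optimal_persuasion_profile mu0 uS uR sig rho \<longrightarrow>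
        (\<exists>m\<in>used_messages sig.
          card (argmax_set (\<lambda>a. \<Sum>w\<in>UNIV. posterior mu0 sig m w * uR a w)) \<ge> 2))"
proof -
  let ?indifferent = "\<forall>(sig :: 'w \<Rightarrow> 'm \<Rightarrow> real) rho. optimal_persuasion_profile mu0 uS uR sig rho \<longrightarrow>
        (\<exists>m\<in>used_messages sig.
          card (argmax_set (\<lambda>a. \<Sum>w\<in>UNIV. posterior mu0 sig m w * uR a w)) \<ge> 2)"
  have 1: "\<not> ?indifferent" if "\<not> values_randomization mu0 uS uR TYPE('m)"
  proof -
    obtain sig :: "'w \<Rightarrow> 'm \<Rightarrow> real" and rho where
      prof: "persuasion_profile mu0 uR sig rho" and part: "partitional sig" and
      pay: "payoff mu0 uS sig rho = partitional_persuasion_payoff mu0 uS uR TYPE('m)"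
      using partitional_persuasion_payoff_attained[OF prior] by metis
    \<comment> \<open>Without a strict gain from randomization, the best partitional profile already
      attains the persuasion payoff.\<close>
    have opt: "optimal_persuasion_profile mu0 uS uR sig rho"
      using that prof pay by (simp add: values_randomization_def optimal_iff_ge[OF prior])
    have msg: "msg_strategy sig"
      using prof by (simp add: persuasion_profile_def)
    have "\<not> card (argmax_set (\<lambda>a. \<Sum>w\<in>UNIV. posterior mu0 sig m w * uR a w)) \<ge> 2"
      if "m \<in> used_messages sig" for m
      using partitional_unique_responses[OF msg part that, of mu0 uR] distinct
      by (simp add: argmax_posterior_eq_argmax_interim[OF prior msg that])
    with opt show ?thesis
      by blast
  qed
  have 2: "\<not> commitment_valuable mu0 uS uR TYPE('m)" if not_indifferent: "\<not> ?indifferent"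
  proof -
    obtain sig :: "'w \<Rightarrow> 'm \<Rightarrow> real" and rho where
      opt: "optimal_persuasion_profile mu0 uS uR sig rho" and
      uniq: "\<And>m. m \<in> used_messages sig \<Longrightarrow>
        \<not> card (argmax_set (\<lambda>a. \<Sum>w\<in>UNIV. posterior mu0 sig m w * uR a w)) \<ge> 2"
      using not_indifferent by blast
    have msg: "msg_strategy sig"
      using opt by (simp add: optimal_persuasion_profile_def persuasion_profile_def)
    obtain rho' where "cheap_talk_eq mu0 uS uR sig rho'"
      "payoff mu0 uS sig rho' = payoff mu0 uS sig rho"
      using unique_responses_imp_cheap_talk[OF prior opt] uniq
      by (metis argmax_posterior_eq_argmax_interim[OF prior msg])
    then have "payoff mu0 uS sig rho \<le> cheap_talk_payoff mu0 uS uR TYPE('m)"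
      using cheap_talk_payoff_attained[OF prior, of uS uR] by metis
    then show ?thesis
      using opt by (simp add: commitment_valuable_def optimal_persuasion_profile_def)
  qed
  have 3: "\<not> values_randomization mu0 uS uR TYPE('m)" if "\<not> commitment_valuable mu0 uS uR TYPE('m)"
  proof -
    obtain sig :: "'w \<Rightarrow> 'm \<Rightarrow> real" and rho where
      eq: "cheap_talk_eq mu0 uS uR sig rho" and
      pay: "payoff mu0 uS sig rho = cheap_talk_payoff mu0 uS uR TYPE('m)"
      using cheap_talk_payoff_attained[OF prior] by metis
    \<comment> \<open>Without a strict gain from commitment, the best cheap-talk equilibrium is an
      optimal persuasion profile, so outcome uniqueness applies to it.\<close>
    have opt: "optimal_persuasion_profile mu0 uS uR sig rho"
      using that pay cheap_talk_eq_imp_persuasion_profile[OF eq]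
      by (simp add: commitment_valuable_def optimal_iff_ge[OF prior])
    have pure: "a = b" if "m \<in> used_messages sig" "rho m a > 0" "rho m b > 0" for m a b
      by (rule optimal_response_pure[OF prior opt _ that]) (rule uniq)
    obtain sig' :: "'w \<Rightarrow> 'm \<Rightarrow> real" where "persuasion_profile mu0 uR sig' rho" "partitional sig'"
      "payoff mu0 uS sig' rho = payoff mu0 uS sig rho"
      by (rule pure_cheap_talk_imp_partitional[OF prior eq _ inj]) (use pure in blast)+
    then have "payoff mu0 uS sig rho \<le> partitional_persuasion_payoff mu0 uS uR TYPE('m)"
      using partitional_persuasion_payoff_attained[OF prior, of uR uS] by metis
    then show ?thesis
      using opt by (simp add: values_randomization_def optimal_persuasion_profile_def)
  qed
  show "commitment_valuable mu0 uS uR TYPE('m) \<longleftrightarrow> values_randomization mu0 uS uR TYPE('m)"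
    using 1 2 3 by blast
  show "values_randomization mu0 uS uR TYPE('m) \<longleftrightarrow> ?indifferent"
    using 1 2 3 by blast
qed

theorem mainTheorem2:
  fixes mu0 :: "'w::finite \<Rightarrow> real"
  assumes "is_prior mu0"
    and "CARD('m::finite) > max CARD('w) CARD('a::finite)"
  shows "\<exists>E :: (bool \<times> 'a \<times> 'w \<Rightarrow> real) set.
           E \<subseteq> env_cube \<and> E \<in> sets env_lebesgue \<and> emeasure env_lebesgue E = 1 \<and>
           (\<forall>e\<in>E.
              (commitment_valuable mu0 (envS e) (envR e) TYPE('m)
                 \<longleftrightarrow> values_randomization mu0 (envS e) (envR e) TYPE('m)) \<and>
              (values_randomization mu0 (envS e) (envR e) TYPE('m)
                 \<longleftrightarrow> (\<forall>(sig :: 'w \<Rightarrow> 'm \<Rightarrow> real) rho.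
                        optimal_persuasion_profile mu0 (envS e) (envR e) sig rho \<longrightarrow>
                        (\<exists>m\<in>used_messages sig.
                           card (argmax_set (\<lambda>a. \<Sum>w\<in>UNIV. posterior mu0 sig m w * envR e a w)) \<ge> 2))))"
    (is "\<exists>E. E \<subseteq> env_cube \<and> E \<in> sets env_lebesgue \<and> emeasure env_lebesgue E = 1 \<and> (\<forall>e\<in>E. ?P e)")
proof -
  have "AE e in env_lebesgue. ?P e"
    using AE_unique_outcome[OF assms(1), where 'm = 'm and 'a = 'a] AE_envS_inj
      AE_partial_sums_distinct[OF assms(1)]
  proof eventually_elim
    case (elim e)
    show ?case
      using elim
      by (intro conjI commitment_randomization_equivalences[OF assms(1)]) blast+
  qed
  then show ?thesis
    by (rule AE_imp_full_measure_subset_env_cube)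
qed

end
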